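(* Let $(C,(O_j)_{j\in[1..n]},L,Q)$ be a PCO specification. Algorithm G, instantiated with CR-Broadcast, implements a Process-Commutative Object specified by the tuple $(C,(O_j)_j,L,Q)$ in the system model $\mathit{CAMP}_{n,t}[\emptyset]$. That is, Algorithm G provides each process $p_i$ with the operations contained in $C\cup O_i\cup Q$ and, for each of its executions, represented by the corresponding history $H$: (1) all the operations invoked by correct processes terminate; and (2) there is a crash-corrected history $H'$ of $H$ such that for each process $p_i$ there is a PCO-legal serialization $S_i$ of $\widehat{H'}_i$, where $\widehat{H'}_i$ is $p_i$'s perceived history of $H'$.
   Context: **PCO specification.** $\Pi=\{p_1,\dots,p_n\}$ is the set of processes. A PCO (Process-Commutative Object) specification is a tuple $(C,(O_j)_{j\in[1..n]},L,Q)$. $C$ is the set of common updates, accessible to all processes and commuting with any other operation. $O_i$ is the set of updates that are exclusive to $p_i$; they do not commute with each other. Put $\Sigma=C\cup\bigcup_i O_i$ and $I=\Sigma\times\Sigma\setminus\bigcup_i(O_i\times O_i)$. Two words $u,v\in\Sigma^*$ satisfy $u\sim_I v$ iff one can be transformed into the other by exchanging adjacent letters that form a pair in $I$. $\mathbb{M}(\Sigma)=\Sigma^*/{\sim_I}$ is the trace monoid, $[u]_I$ is the class (trace) of $u$, and $\oplus$ is concatenation of words or traces; a trace is often denoted by one of its representative words. $L\subseteq\mathbb{M}(\Sigma)$ is a language of finite traces, and $Q$ is a set of query functions $q:L\to\mathbb{V}$, where $\mathbb{V}$ is a set of output values. $L$ must satisfy: *Initial emptiness*: $[\epsilon]_I\in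 L$; *$C^*$-closure*: $LC^*\subseteq L$; *$I$-diamond closure*: given $v\in L$, $\mathsf{op}_i\in O_i$ and a trace $z\in\mathbb{M}(\Sigma\setminus O_i)$, if $\{v\oplus\mathsf{op}_i,\ v\oplus z\}\subseteq L$ then $v\oplus z\oplus\mathsf{op}_i\in L$. A function $\mathsf{output}:\Sigma\times\mathbb{M}(\Sigma)\to\mathbb{V}$ gives the value $\mathsf{output}(\mathsf{up},v)$ returned by update $\mathsf{up}$ when applied to the state captured by the trace $v$. **Model $\mathit{CAMP}_{n,t}[\emptyset]$.** $n$ asynchronous processes, each pair connected by an asynchronous reliable bidirectional authenticated channel (no corruption, creation or loss of messages, arbitrary finite delays). Up to $t<n$ processes may crash (stop prematurely and definitively while executing the algorithm). Processes that crash are faulty, the others are correct. **CR-Broadcast.** Provides an operation r-broadcast of a message $m$ with a sequence number $\mathit{sn}$, written $\langle\mathit{sn},m\rangle$, and a callback r-delivered, with: *Validity*: if $p_i$ r-delivers a message with sequence number $\mathit{sn}$ from $p_j$, then $p_j$ r-broadcast it with sequence number $\mathit{sn}$; *Integrity*: for each $\mathit{sn}$ and sender $p_j$, a process $p_i$ r-delivers at most one message with sequence number $\mathit{sn}$ from $p_j$; *Termination-1*: if a correct process r-broadcasts a message, it r-delivers it; *Termination-2*: if a process r-delivers a message from a (correct or faulty) process $p_j$, then all correct processes r-deliver it. **Algorithm G (code for $p_i$).** Local variables: $\mathit{seq}_i\in\Sigma^*$, initially $\epsilon$ (the sequence of updates processed so far by $p_i$); $\mathit{sn}_i\in\mathbb{N}$,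 initially $0$; $\mathit{del}_i[1..n]\in\mathbb{N}^n$, initially $[0,\dots,0]$. - Invoking a query $q\in Q$: return $q(\mathit{seq}_i)$. - Invoking an update $\mathsf{up}\in\Sigma$: if $\mathsf{up}\in C\cup O_i$ and $[\mathit{seq}_i\oplus\mathsf{up}]_I\in L$, then $\mathit{sn}_i\leftarrow\mathit{sn}_i+1$; r-broadcast $\langle\mathit{sn}_i,\textsc{apply}(\mathsf{up})\rangle$; wait until $\mathit{del}_i[i]=\mathit{sn}_i$ (i.e. until $p_i$ has processed its own broadcast); return $\mathsf{output}(\mathsf{up},\mathit{seq}_i)$. Otherwise raise abort (this should not happen if the application respects the tested condition). - When $\langle\mathit{sn},\textsc{apply}(\mathsf{up})\rangle$ is r-delivered from $p_j$: wait until ($\mathsf{up}\in C\cup O_j$ and $\mathit{sn}=\mathit{del}_i[j]+1$ and $[\mathit{seq}_i\oplus\mathsf{up}]_I\in L$); then $\mathit{seq}_i\leftarrow\mathit{seq}_i\oplus\mathsf{up}$; $\mathit{del}_i[j]\leftarrow\mathit{sn}$. **Histories.** A sequential execution is a sequence of invocations $e_k=(\mathsf{op},\mathit{val},p)$ with $\mathsf{op}\in\Sigma\cup Q$, $\mathit{val}\in\mathbb{V}\cup\{?\}$ and $p\in\Pi$ the invoking process, where $?\notin\mathbb{V}$ is the masked value (other values are visible). A local history $E_i$ of $p_i$ is a sequential execution in which every operation is invoked by $p_i$ and authorized to $p_i$ (it is in $C\cup O_i\cup Q$) and each returned value is known ($\neq\ ?$); its order is the local process order of $p_i$. A history is $H=(E_1,\dots,E_n)$,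 one local history per process. A *crash-corrected history* of $H$ is $H'=(E'_1,\dots,E'_n)$ with $E'_i=E_i$ if $p_i$ is correct, and $E'_i$ equal either to $E_i$ or to $E_i$ minus its last element if $p_i$ is faulty. The perceived history $\widehat{H'}_i=(\widehat{E'}_1,\dots,\widehat{E'}_n)$ has $\widehat{E'}_i=E'_i$ and, for $j\neq i$, $\widehat{E'}_j$ is obtained from $E'_j$ by removing all queries and replacing the value of each remaining update by $?$. A *serialization* of a history is a sequential execution which contains all invocations of the history and respects all local process orders. **PCO-legality.** A sequential execution $S=(e_k)_k$ is PCO-legal if: *Process Authorization*: every $(\mathsf{op},\mathit{val},p_i)\in S$ has $\mathsf{op}\in C\cup O_i\cup Q$; *Update Legality*: every prefix $u$ of the sequence of updates of $S$ satisfies $[u]_I\in L$; *Output and Query Validity*: if $e_k=(q,\mathit{val},p)$ with $q\in Q$, then $\mathit{val}=q([u_{<k}]_I)$, and if $e_k=(\mathsf{up},\mathit{val},p)$ with $\mathsf{up}\in\Sigma$ and $\mathit{val}\neq\ ?$, then $\mathit{val}=\mathsf{output}(\mathsf{up},[u_{<k}]_I)$, where $u_{<k}$ is the sequence of updates among $e_1,\dots,e_{k-1}$.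
   Formalization: An update up returns output(up, ·) on the value of seq_i just before up is appended (with seq_i already containing up the claim fails: C={c}, output = length); an operation interrupted by a crash gets the value computed from the crash state or already recorded. *)

theory Defs
  imports "HOL-Library.Infinite_Set" "HOL-Library.Cardinality"
begin

section \<open>PCO specifications and traces\<close>

text \<open>The set of processes is a finite type \<open>'p\<close>, so that the number of processes is
  \<open>CARD('p)\<close>. A trace over the alphabet is represented by its equivalence class of words.
  Query functions are total on \<open>'a trace\<close>; only their values on the language \<open>lang\<close> matter.\<close>

type_synonym 'a trace = "'a list set"

record ('a, 'p, 'v) pco =
  common :: "'a set"
  own :: "'p \<Rightarrow> 'a set"
  lang :: "'a trace set"
  queries :: "('a trace \<Rightarrow> 'v) set"

definition updates :: "('a, 'p, 'v) pco \<Rightarrow> 'a set" where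
  "updates P = common P \<union> (\<Union>i. own P i)"

definition indep :: "('a, 'p, 'v) pco \<Rightarrow> ('a \<times> 'a) set" where
  "indep P = updates P \<times> updates P - (\<Union>i. own P i \<times> own P i)"

inductive swap :: "('a \<times> 'a) set \<Rightarrow> 'a list \<Rightarrow> 'a list \<Rightarrow> bool" for I where
  "(a, b) \<in> I \<Longrightarrow> swap I (x @ [a, b] @ y) (x @ [b, a] @ y)"

definition trace_of :: "('a, 'p, 'v) pco \<Rightarrow> 'a list \<Rightarrow> 'a trace" where
  "trace_of P u = {v. (swap (indep P))\<^sup>*\<^sup>* u v}"

text \<open>The traces all of whose letters are in \<open>A\<close>; for \<open>A = updates P\<close> this is the trace monoid.\<close>

definition traces :: "('a, 'p, 'v) pco \<Rightarrow> 'a set \<Rightarrow> 'a trace set" where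
  "traces P A = trace_of P ` lists A"

definition tconcat :: "('a, 'p, 'v) pco \<Rightarrow> 'a trace \<Rightarrow> 'a trace \<Rightarrow> 'a trace" where
  "tconcat P T U = (\<Union>u\<in>T. \<Union>v\<in>U. trace_of P (u @ v))"

text \<open>The disjointness conditions express that the updates in \<open>own P i\<close> are exclusive to \<open>i\<close> and
  that common updates commute with every operation.\<close>

definition pco_spec :: "('a, 'p, 'v) pco \<Rightarrow> bool" where
  "pco_spec P \<longleftrightarrow>
     (\<forall>i. common P \<inter> own P i = {}) \<and>
     (\<forall>i j. i \<noteq> j \<longrightarrow> own P i \<inter> own P j = {}) \<and>
     lang P \<subseteq> traces P (updates P) \<and>
     trace_of P [] \<in> lang P \<and>
     (\<forall>v\<in>lang P. \<forall>w\<in>traces P (common P). tconcat P v w \<in> lang P) \<and>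
     (\<forall>v\<in>lang P. \<forall>i. \<forall>a\<in>own P i. \<forall>z\<in>traces P (updates P - own P i).
        tconcat P v (trace_of P [a]) \<in> lang P \<and> tconcat P v z \<in> lang P
        \<longrightarrow> tconcat P (tconcat P v z) (trace_of P [a]) \<in> lang P)"

datatype ('a, 'v) oper = Update 'a | Query "'a trace \<Rightarrow> 'v"

definition authorized :: "('a, 'p, 'v) pco \<Rightarrow> 'p \<Rightarrow> ('a, 'v) oper set" where
  "authorized P i = Update ` (common P \<union> own P i) \<union> Query ` queries P"


section \<open>Finite and infinite sequences\<close>

text \<open>A finite or infinite sequence is a function to \<open>option\<close> whose domain is an initial
  segment of the natural numbers.\<close>

type_synonym 'a sq = "nat \<Rightarrow> 'a option"

definition is_sq :: "'a sq \<Rightarrow> bool" where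
  "is_sq s \<longleftrightarrow> (\<forall>k. s (Suc k) \<noteq> None \<longrightarrow> s k \<noteq> None)"

text \<open>The increasing enumeration of a finite or infinite set.\<close>

definition sq_of_set :: "nat set \<Rightarrow> nat sq" where
  "sq_of_set T = (\<lambda>m. if infinite T \<or> m < card T then Some (enumerate T m) else None)"

definition sq_map :: "('a \<Rightarrow> 'b) \<Rightarrow> 'a sq \<Rightarrow> 'b sq" where
  "sq_map f s = (\<lambda>m. map_option f (s m))"

definition sq_filter :: "('a \<Rightarrow> bool) \<Rightarrow> 'a sq \<Rightarrow> 'a sq" where
  "sq_filter Q s =
     (\<lambda>m. case sq_of_set {k. \<exists>e. s k = Some e \<and> Q e} m of None \<Rightarrow> None | Some k \<Rightarrow> s k)"

definition drops_last :: "'a sq \<Rightarrow> 'a sq \<Rightarrow> bool" where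
  "drops_last s s' \<longleftrightarrow> (\<exists>m. s m \<noteq> None \<and> s (Suc m) = None \<and> s' = s(m := None))"


section \<open>Histories, serializations and legality\<close>

text \<open>The value component \<open>None\<close> is the masked value.\<close>

type_synonym ('a, 'p, 'v) invocation = "('a, 'v) oper \<times> 'v option \<times> 'p"
type_synonym ('a, 'p, 'v) history = "'p \<Rightarrow> ('a, 'p, 'v) invocation sq"

definition is_local_history ::
  "('a, 'p, 'v) pco \<Rightarrow> 'p \<Rightarrow> ('a, 'p, 'v) invocation sq \<Rightarrow> bool" where
  "is_local_history P i E \<longleftrightarrow> is_sq E \<and>
     (\<forall>k op val p. E k = Some (op, val, p) \<longrightarrow> p = i \<and> op \<in> authorized P i \<and> val \<noteq> None)"

definition is_history :: "('a, 'p, 'v) pco \<Rightarrow> ('a, 'p, 'v) history \<Rightarrow> bool" where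
  "is_history P H \<longleftrightarrow> (\<forall>i. is_local_history P i (H i))"

definition crash_corrected ::
  "'p set \<Rightarrow> ('a, 'p, 'v) history \<Rightarrow> ('a, 'p, 'v) history \<Rightarrow> bool" where
  "crash_corrected faulty H H' \<longleftrightarrow>
     (\<forall>i. H' i = H i \<or> i \<in> faulty \<and> drops_last (H i) (H' i))"

definition is_update :: "('a, 'p, 'v) invocation \<Rightarrow> bool" where
  "is_update e \<longleftrightarrow> (\<exists>a val p. e = (Update a, val, p))"

definition mask :: "('a, 'p, 'v) invocation \<Rightarrow> ('a, 'p, 'v) invocation" where
  "mask = (\<lambda>(op, val, p). (op, None, p))"

definition perceived :: "'p \<Rightarrow> ('a, 'p, 'v) history \<Rightarrow> ('a, 'p, 'v) history" where
  "perceived i H = (\<lambda>j. if j = i then H j else sq_map mask (sq_filter is_update (H j)))"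

text \<open>\<open>pos (i, m)\<close> is the position in \<open>S\<close> of the \<open>m\<close>-th invocation of the local history of \<open>i\<close>.\<close>

definition serialization ::
  "('a, 'p, 'v) invocation sq \<Rightarrow> ('a, 'p, 'v) history \<Rightarrow> bool" where
  "serialization S H \<longleftrightarrow> is_sq S \<and>
     (\<exists>pos. bij_betw pos {(i, m). H i m \<noteq> None} {k. S k \<noteq> None} \<and>
        (\<forall>i m. H i m \<noteq> None \<longrightarrow> S (pos (i, m)) = H i m) \<and>
        (\<forall>i m m'. m < m' \<and> H i m' \<noteq> None \<longrightarrow> pos (i, m) < pos (i, m')))"

text \<open>The updates among the first \<open>k\<close> invocations of \<open>S\<close>. The finite prefixes of the update
  sequence of \<open>S\<close> are exactly the words \<open>updates_before S k\<close>.\<close>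

definition updates_before :: "('a, 'p, 'v) invocation sq \<Rightarrow> nat \<Rightarrow> 'a list" where
  "updates_before S k =
     concat (map (\<lambda>m. case S m of Some (Update a, _, _) \<Rightarrow> [a] | _ \<Rightarrow> []) [0..<k])"

definition pco_legal ::
  "('a, 'p, 'v) pco \<Rightarrow> ('a \<Rightarrow> 'a trace \<Rightarrow> 'v) \<Rightarrow> ('a, 'p, 'v) invocation sq \<Rightarrow> bool" where
  "pco_legal P out S \<longleftrightarrow>
     (\<forall>k op val p. S k = Some (op, val, p) \<longrightarrow> op \<in> authorized P p) \<and>
     (\<forall>k. trace_of P (updates_before S k) \<in> lang P) \<and>
     (\<forall>k q val p. S k = Some (Query q, val, p)
        \<longrightarrow> val = Some (q (trace_of P (updates_before S k)))) \<and>
     (\<forall>k a val p. S k = Some (Update a, val, p) \<and> val \<noteq> None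
        \<longrightarrow> val = Some (out a (trace_of P (updates_before S k))))"


section \<open>CR-Broadcast\<close>

text \<open>\<open>bcast k j sn m\<close>: at time \<open>k\<close>, process \<open>j\<close> r-broadcasts \<open>m\<close> with sequence number \<open>sn\<close>;
  \<open>dlvr k i j sn m\<close>: at time \<open>k\<close>, process \<open>i\<close> r-delivers \<open>m\<close> with sequence number \<open>sn\<close> from \<open>j\<close>.\<close>

definition cr_broadcast ::
  "'p set \<Rightarrow> (nat \<Rightarrow> 'p \<Rightarrow> nat \<Rightarrow> 'm \<Rightarrow> bool) \<Rightarrow> (nat \<Rightarrow> 'p \<Rightarrow> 'p \<Rightarrow> nat \<Rightarrow> 'm \<Rightarrow> bool) \<Rightarrow> bool" where
  "cr_broadcast faulty bcast dlvr \<longleftrightarrow>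
     \<comment> \<open>Validity\<close>
     (\<forall>k i j sn m. dlvr k i j sn m \<longrightarrow> (\<exists>k'<k. bcast k' j sn m)) \<and>
     \<comment> \<open>Integrity\<close>
     (\<forall>i j sn k m k' m'. dlvr k i j sn m \<and> dlvr k' i j sn m' \<longrightarrow> k = k' \<and> m = m') \<and>
     \<comment> \<open>Termination-1\<close>
     (\<forall>k i sn m. i \<notin> faulty \<and> bcast k i sn m \<longrightarrow> (\<exists>k'. dlvr k' i i sn m)) \<and>
     \<comment> \<open>Termination-2\<close>
     (\<forall>k i j sn m. dlvr k i j sn m \<longrightarrow> (\<forall>i'. i' \<notin> faulty \<longrightarrow> (\<exists>k'. dlvr k' i' j sn m)))"


section \<open>The algorithm\<close>

text \<open>Control point of the operation being executed: \<open>Querying q\<close>, query invoked but not yet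
  returned; \<open>Accepted a\<close>, update that passed the test but is not yet r-broadcast; \<open>Waiting a\<close>,
  update r-broadcast but not yet returned.\<close>

datatype ('a, 'v) phase = Idle | Querying "'a trace \<Rightarrow> 'v" | Accepted 'a | Waiting 'a

text \<open>\<open>waiting_msgs\<close> contains the messages \<open>(j, sn, a)\<close> that were r-delivered and whose handler has not
  yet passed its wait condition. \<open>result\<close> is the value of \<open>out a\<close> on the state to which the
  process's own update \<open>a\<close> is applied, i.e. on \<open>local_seq\<close> just before \<open>a\<close> is appended to it; this is
  the value that the update returns. (Evaluating \<open>out a\<close> on the sequence after \<open>a\<close> was appended
  would contradict legality, which evaluates it on the updates preceding \<open>a\<close>.)\<close>

record ('a, 'p, 'v) lstate =
  local_seq :: "'a list"
  local_sn :: nat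
  local_del :: "'p \<Rightarrow> nat"
  waiting_msgs :: "('p \<times> nat \<times> 'a) set"
  phase :: "('a, 'v) phase"
  result :: "'v option"
  alive :: bool

definition init_lstate :: "('a, 'p, 'v) lstate" where
  "init_lstate = \<lparr>local_seq = [], local_sn = 0, local_del = (\<lambda>_. 0), waiting_msgs = {},
                  phase = Idle, result = None, alive = True\<rparr>"

text \<open>\<open>Abort i a\<close> is an invocation of the update \<open>a\<close> by \<open>i\<close> that raises abort.
  \<open>RDeliver i j sn a\<close> and \<open>Apply i j sn a\<close> are the r-delivery and the processing, by \<open>i\<close>, of the
  message \<open>a\<close> with sequence number \<open>sn\<close> from \<open>j\<close>.\<close>

datatype ('a, 'p, 'v) event =
    Invoke 'p "('a, 'v) oper"
  | Return 'p "('a, 'v) oper" 'v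
  | Abort 'p 'a
  | RBroadcast 'p nat 'a
  | RDeliver 'p 'p nat 'a
  | Apply 'p 'p nat 'a
  | Crash 'p
  | Stutter

inductive lstep ::
  "('a, 'p, 'v) pco \<Rightarrow> ('a \<Rightarrow> 'a trace \<Rightarrow> 'v) \<Rightarrow> 'p \<Rightarrow> ('a, 'p, 'v) lstate \<Rightarrow>
   ('a, 'p, 'v) event \<Rightarrow> ('a, 'p, 'v) lstate \<Rightarrow> bool" for P out i where
  query_invoke:
    "\<lbrakk>alive s; phase s = Idle; q \<in> queries P\<rbrakk>
     \<Longrightarrow> lstep P out i s (Invoke i (Query q)) (s\<lparr>phase := Querying q\<rparr>)"
| query_return:
    "\<lbrakk>alive s; phase s = Querying q\<rbrakk>
     \<Longrightarrow> lstep P out i s (Return i (Query q) (q (trace_of P (local_seq s)))) (s\<lparr>phase := Idle\<rparr>)"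
| update_invoke:
    "\<lbrakk>alive s; phase s = Idle; a \<in> common P \<union> own P i; trace_of P (local_seq s @ [a]) \<in> lang P\<rbrakk>
     \<Longrightarrow> lstep P out i s (Invoke i (Update a)) (s\<lparr>phase := Accepted a\<rparr>)"
| update_abort:
    "\<lbrakk>alive s; phase s = Idle; a \<in> updates P;
      \<not> (a \<in> common P \<union> own P i \<and> trace_of P (local_seq s @ [a]) \<in> lang P)\<rbrakk>
     \<Longrightarrow> lstep P out i s (Abort i a) s"
| update_broadcast:
    "\<lbrakk>alive s; phase s = Accepted a\<rbrakk>
     \<Longrightarrow> lstep P out i s (RBroadcast i (local_sn s + 1) a)
           (s\<lparr>local_sn := local_sn s + 1, result := None, phase := Waiting a\<rparr>)"
| update_return:
    "\<lbrakk>alive s; phase s = Waiting a; local_del s i = local_sn s; result s = Some v\<rbrakk>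
     \<Longrightarrow> lstep P out i s (Return i (Update a) v) (s\<lparr>phase := Idle\<rparr>)"
| deliver:
    "alive s
     \<Longrightarrow> lstep P out i s (RDeliver i j sn a)
           (s\<lparr>waiting_msgs := insert (j, sn, a) (waiting_msgs s)\<rparr>)"
| apply_msg:
    "\<lbrakk>alive s; (j, sn, a) \<in> waiting_msgs s;
      a \<in> common P \<union> own P j; sn = local_del s j + 1; trace_of P (local_seq s @ [a]) \<in> lang P\<rbrakk>
     \<Longrightarrow> lstep P out i s (Apply i j sn a)
           (s\<lparr>waiting_msgs := waiting_msgs s - {(j, sn, a)},
              local_seq := local_seq s @ [a],
              local_del := (local_del s)(j := sn),
              result := (if j = i then Some (out a (trace_of P (local_seq s))) else result s)\<rparr>)"
| crash:
    "alive s \<Longrightarrow> lstep P out i s (Crash i) (s\<lparr>alive := False\<rparr>)"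

definition gstep ::
  "('a, 'p, 'v) pco \<Rightarrow> ('a \<Rightarrow> 'a trace \<Rightarrow> 'v) \<Rightarrow> ('p \<Rightarrow> ('a, 'p, 'v) lstate) \<Rightarrow>
   ('a, 'p, 'v) event \<Rightarrow> ('p \<Rightarrow> ('a, 'p, 'v) lstate) \<Rightarrow> bool" where
  "gstep P out g e g' \<longleftrightarrow>
     e = Stutter \<and> g' = g \<or> (\<exists>i s'. lstep P out i (g i) e s' \<and> g' = g(i := s'))"

definition enabled ::
  "('a, 'p, 'v) pco \<Rightarrow> ('a \<Rightarrow> 'a trace \<Rightarrow> 'v) \<Rightarrow> ('p \<Rightarrow> ('a, 'p, 'v) lstate) \<Rightarrow>
   ('a, 'p, 'v) event \<Rightarrow> bool" where
  "enabled P out g e \<longleftrightarrow> (\<exists>g'. gstep P out g e g')"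


section \<open>Executions\<close>

text \<open>Time is discrete; \<open>st k\<close> is the global state before the event \<open>ev k\<close>. Stuttering embeds finite
  executions. Asynchrony is reflected by the absence of any bound on the time at which an event
  occurs: a correct process is only required not to leave a continuously enabled step of its current
  operation, or of one of its message handlers, undone forever. Invocations are not subject to
  fairness.\<close>

definition faulty_set :: "(nat \<Rightarrow> 'p \<Rightarrow> ('a, 'p, 'v) lstate) \<Rightarrow> 'p set" where
  "faulty_set st = {i. \<exists>k. \<not> alive (st k i)}"

definition weakly_fair ::
  "('a, 'p, 'v) pco \<Rightarrow> ('a \<Rightarrow> 'a trace \<Rightarrow> 'v) \<Rightarrow> (nat \<Rightarrow> 'p \<Rightarrow> ('a, 'p, 'v) lstate) \<Rightarrow>
   (nat \<Rightarrow> ('a, 'p, 'v) event) \<Rightarrow> ('a, 'p, 'v) event set \<Rightarrow> bool" where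
  "weakly_fair P out st ev T \<longleftrightarrow>
     (\<forall>k. (\<forall>k'\<ge>k. \<exists>e\<in>T. enabled P out (st k') e) \<longrightarrow> (\<exists>k'\<ge>k. ev k' \<in> T))"

definition op_steps :: "'p \<Rightarrow> ('a, 'p, 'v) event set" where
  "op_steps i = {e. (\<exists>op v. e = Return i op v) \<or> (\<exists>sn a. e = RBroadcast i sn a)}"

definition execution ::
  "('a, 'p, 'v) pco \<Rightarrow> ('a \<Rightarrow> 'a trace \<Rightarrow> 'v) \<Rightarrow> nat \<Rightarrow> (nat \<Rightarrow> 'p \<Rightarrow> ('a, 'p, 'v) lstate) \<Rightarrow>
   (nat \<Rightarrow> ('a, 'p, 'v) event) \<Rightarrow> bool" where
  "execution P out t st ev \<longleftrightarrow>
     (\<forall>i. st 0 i = init_lstate) \<and>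
     (\<forall>k. gstep P out (st k) (ev k) (st (Suc k))) \<and>
     card (faulty_set st) \<le> t \<and>
     cr_broadcast (faulty_set st)
       (\<lambda>k j sn a. ev k = RBroadcast j sn a) (\<lambda>k i j sn a. ev k = RDeliver i j sn a) \<and>
     (\<forall>i. i \<notin> faulty_set st \<longrightarrow>
        weakly_fair P out st ev (op_steps i) \<and>
        (\<forall>j sn a. weakly_fair P out st ev {Apply i j sn a}))"


section \<open>The history of an execution\<close>

text \<open>The operation that \<open>i\<close> invokes at time \<open>k\<close> returns \<open>v\<close>.\<close>

definition returns ::
  "(nat \<Rightarrow> ('a, 'p, 'v) event) \<Rightarrow> 'p \<Rightarrow> nat \<Rightarrow> ('a, 'v) oper \<Rightarrow> 'v \<Rightarrow> bool" where
  "returns ev i k op v \<longleftrightarrow> ev k = Invoke i op \<and>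
     (\<exists>k'>k. ev k' = Return i op v \<and> (\<forall>l. k < l \<and> l < k' \<longrightarrow> (\<forall>op'. ev l \<noteq> Invoke i op')))"

text \<open>The value attributed to an operation interrupted by a crash, which has no return event: the
  value it would have returned from the local state \<open>s\<close> in which the process crashed. For an update
  whose own message was already processed this is the recorded result.\<close>

definition interrupted_value ::
  "('a, 'p, 'v) pco \<Rightarrow> ('a \<Rightarrow> 'a trace \<Rightarrow> 'v) \<Rightarrow> 'p \<Rightarrow> ('a, 'p, 'v) lstate \<Rightarrow> ('a, 'v) oper \<Rightarrow> 'v" where
  "interrupted_value P out i s op =
     (case op of
        Query q \<Rightarrow> q (trace_of P (local_seq s))
      | Update a \<Rightarrow>
          if phase s = Waiting a \<and> local_del s i = local_sn s \<and> result s \<noteq> None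
          then the (result s) else out a (trace_of P (local_seq s)))"

definition invoked_value ::
  "('a, 'p, 'v) pco \<Rightarrow> ('a \<Rightarrow> 'a trace \<Rightarrow> 'v) \<Rightarrow> (nat \<Rightarrow> 'p \<Rightarrow> ('a, 'p, 'v) lstate) \<Rightarrow>
   (nat \<Rightarrow> ('a, 'p, 'v) event) \<Rightarrow> 'p \<Rightarrow> nat \<Rightarrow> ('a, 'v) oper \<Rightarrow> 'v" where
  "invoked_value P out st ev i k op =
     (if \<exists>v. returns ev i k op v then THE v. returns ev i k op v
      else interrupted_value P out i (st (LEAST l. \<not> alive (st l i)) i) op)"

text \<open>The local history of \<open>i\<close> lists its invocations in the order of their times. Aborted
  invocations have no effect and no value and are not part of it.\<close>

definition history_of ::
  "('a, 'p, 'v) pco \<Rightarrow> ('a \<Rightarrow> 'a trace \<Rightarrow> 'v) \<Rightarrow> (nat \<Rightarrow> 'p \<Rightarrow> ('a, 'p, 'v) lstate) \<Rightarrow>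
   (nat \<Rightarrow> ('a, 'p, 'v) event) \<Rightarrow> ('a, 'p, 'v) history" where
  "history_of P out st ev = (\<lambda>i.
     sq_map (\<lambda>k. let op = (THE op. ev k = Invoke i op)
                 in (op, Some (invoked_value P out st ev i k op), i))
       (sq_of_set {k. \<exists>op. ev k = Invoke i op}))"

end

theory Submission
  imports Defs
begin

text \<open>Every process applies the updates of each other process in the order of their sequence numbers.
  Hence, whenever one process has applied at least the updates known to another one, the traces of
  their sequences differ by a factor without updates of the issuing process, and the diamond closure
  carries the legality of an update from its issuer to everyone else. By induction on the time of the
  broadcast, every message delivered by a correct process is eventually applied there, which gives
  termination and makes all correct processes apply the same updates.

  A correct process serializes its perceived history by the order in which it applies updates and
  returns from queries. For a faulty process this order, cut off at the crash, is continued by its own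
  interrupted update, if others apply it, and then by the updates that a correct process applies and
  that it has not yet seen; legality again follows from the diamond closure. The corrected history
  drops exactly the interrupted queries and the updates that nobody applies.\<close>

section \<open>Enumerations and serializations\<close>

text \<open>CR-Broadcast orders nothing, not even the messages of one sender: the handlers restore
  the order per sender through \<open>local_del\<close>, and between senders only the test against
  \<open>lang P\<close> acts. Fairness speaks only of steps that stay enabled, so this test must not
  merely succeed once but go on succeeding while the receiver applies further updates. This is why
  legality is transferred to every larger word with equally many updates of the issuer. Words are
  compared through numbers: the n-th update of a process is the same everywhere, so a vector of
  counts fixes all projections to single issuers. The place of an interrupted update is not free.
  Its value is attributed in the local state at the crash, so it must directly follow the local
  events and precede every update that the crashed process has not seen. Orders are given as partial
  functions from time slots to invocations; gaps are squeezed out only when a serialization is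
  formed.\<close>

text \<open>Positions are ranks, that is, numbers of smaller elements. This form treats finite and
  infinite sets alike and keeps \<open>enumerate\<close> out of the later arguments.\<close>

lemma sq_of_set_Some_iff:
  "sq_of_set T m = Some k \<longleftrightarrow> k \<in> T \<and> card {x \<in> T. x < k} = m"
proof -
  define D where "D = {m. infinite T \<or> m < card T}"
  have mono: "enumerate T m < enumerate T n \<longleftrightarrow> m < n" if "m \<in> D" "n \<in> D" for m n
    using that unfolding D_def by (cases "finite T") auto
  have mem: "enumerate T m \<in> T" if "m \<in> D" for m
    using that unfolding D_def by (auto intro: enumerate_in_set finite_enumerate_in_set)
  have ex: "\<exists>m\<in>D. enumerate T m = k" if "k \<in> T" for k
    using enumerate_Ex[of T k] finite_enumerate_Ex[of T k] that unfolding D_def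
    by (cases "finite T") auto
  have down: "n \<in> D" if "m \<in> D" "n < m" for m n using that unfolding D_def by auto
  have card: "card {x \<in> T. x < enumerate T m} = m" if m: "m \<in> D" for m
  proof -
    have "{x \<in> T. x < enumerate T m} = enumerate T ` {..<m}"
      using ex mono mem down m by (fastforce simp: image_iff)
    moreover have "inj_on (enumerate T) {..<m}"
      by (rule inj_onI) (metis down m lessThan_iff less_irrefl linorder_neqE_nat mono)
    ultimately show ?thesis by (simp add: card_image)
  qed
  have "sq_of_set T m = Some k \<longleftrightarrow> m \<in> D \<and> enumerate T m = k"
    unfolding sq_of_set_def D_def by auto
  then show ?thesis using ex mem card by metis
qed

lemma sq_of_set_None_iff:
  "sq_of_set T m = None \<longleftrightarrow> finite T \<and> card T \<le> m"
  unfolding sq_of_set_def by auto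

lemma is_sq_sq_map: "is_sq (sq_map f s) \<longleftrightarrow> is_sq s"
  unfolding is_sq_def sq_map_def by simp

lemma is_sq_sq_of_set: "is_sq (sq_of_set T)"
  unfolding is_sq_def sq_of_set_def by auto

lemma sq_map_Some_iff: "sq_map f s m = Some y \<longleftrightarrow> (\<exists>x. s m = Some x \<and> f x = y)"
  unfolding sq_map_def by auto

lemma sq_map_None_iff: "sq_map f s m = None \<longleftrightarrow> s m = None"
  unfolding sq_map_def by auto

lemma card_below_less:
  fixes k k' :: nat
  assumes "k \<in> T" "k < k'"
  shows "card {x \<in> T. x < k} < card {x \<in> T. x < k'}"
proof (rule psubset_card_mono)
  show "finite {x \<in> T. x < k'}" by simp
  show "{x \<in> T. x < k} \<subset> {x \<in> T. x < k'}" using assms by auto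
qed

lemma card_below_inj:
  fixes k k' :: nat
  assumes "k \<in> T" "k' \<in> T" "card {x \<in> T. x < k} = card {x \<in> T. x < k'}"
  shows "k = k'"
  using assms card_below_less[of k T k'] card_below_less[of k' T k] by (cases k k' rule: linorder_cases) auto

text \<open>\<open>sq_filter\<close> selects positions, and the position of an element is its rank
  \<open>r\<close> in \<open>T\<close>. As \<open>r\<close> is strictly increasing on
  \<open>T\<close>, ranks among the selected positions agree with ranks among the surviving
  elements.\<close>

lemma sq_filter_sq_of_set:
  "sq_filter Q (sq_map f (sq_of_set T)) = sq_map f (sq_of_set {k \<in> T. Q (f k)})"
proof (rule ext)
  fix m
  define r where "r k = card {x \<in> T. x < k}" for k
  define N where "N = {n. \<exists>e. sq_map f (sq_of_set T) n = Some e \<and> Q e}"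
  have N: "N = r ` {k \<in> T. Q (f k)}"
    unfolding N_def r_def by (auto simp: sq_map_Some_iff sq_of_set_Some_iff)
  have r_less: "r x < r k \<longleftrightarrow> x < k" if "x \<in> T" "k \<in> T" for x k
    using card_below_less[of x T k] card_below_less[of k T x] that unfolding r_def
    by (cases x k rule: linorder_cases) auto
  have card_eq: "card {n \<in> N. n < r k} = card {x \<in> {k \<in> T. Q (f k)}. x < k}" if "k \<in> T" for k
  proof -
    have "{n \<in> N. n < r k} = r ` {x \<in> {k \<in> T. Q (f k)}. x < k}"
      using r_less that unfolding N by auto
    moreover have "inj_on r {x \<in> {k \<in> T. Q (f k)}. x < k}"
      unfolding r_def inj_on_def using card_below_inj[of _ T] by blast
    ultimately show ?thesis by (simp add: card_image)
  qed
  show "sq_filter Q (sq_map f (sq_of_set T)) m = sq_map f (sq_of_set {k \<in> T. Q (f k)}) m"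
  proof (cases "sq_of_set {k \<in> T. Q (f k)} m")
    case None
    then have fin: "finite {k \<in> T. Q (f k)}" and le: "card {k \<in> T. Q (f k)} \<le> m"
      by (auto simp: sq_of_set_None_iff)
    have "finite N" "card N \<le> m" unfolding N using fin le card_image_le[OF fin, of r] by auto
    then have "sq_of_set N m = None" by (simp add: sq_of_set_None_iff)
    then show ?thesis using None unfolding sq_filter_def N_def[symmetric] by (simp add: sq_map_def)
  next
    case (Some k)
    then have k: "k \<in> T" "Q (f k)" "card {x \<in> {k \<in> T. Q (f k)}. x < k} = m"
      by (auto simp: sq_of_set_Some_iff)
    then have "sq_of_set N m = Some (r k)" unfolding sq_of_set_Some_iff
      using N card_eq by auto
    moreover have "sq_of_set T (r k) = Some k" using k by (simp add: sq_of_set_Some_iff r_def)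
    ultimately show ?thesis using Some unfolding sq_filter_def N_def[symmetric]
      by (simp add: sq_map_def)
  qed
qed

lemma drops_last_remove_Max:
  assumes "k \<in> T" and max: "\<And>x. x \<in> T \<Longrightarrow> x \<le> (k :: nat)"
  shows "drops_last (sq_map f (sq_of_set T)) (sq_map f (sq_of_set (T - {k})))"
proof -
  have fin: "finite T" using max by (meson finite_nat_set_iff_bounded_le)
  define m where "m = card {x \<in> T. x < k}"
  have eq: "{x \<in> T. x < k} = T - {k}" using max by force
  have cardT: "card T = Suc m"
    unfolding m_def eq using assms(1) fin by (metis card.remove)
  have "sq_of_set (T - {k}) = (sq_of_set T)(m := None)"
  proof
    fix n
    show "sq_of_set (T - {k}) n = ((sq_of_set T)(m := None)) n"
    proof (cases "n < m")
      case True
      then obtain x where x: "sq_of_set T n = Some x"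
        using cardT fin by (cases "sq_of_set T n") (auto simp: sq_of_set_None_iff)
      then have "x \<in> T" "x \<noteq> k" "card {y \<in> T. y < x} = n"
        using True by (auto simp: sq_of_set_Some_iff m_def)
      moreover have "{y \<in> T - {k}. y < x} = {y \<in> T. y < x}" using max \<open>x \<in> T\<close> by force
      ultimately have "sq_of_set (T - {k}) n = Some x" by (simp add: sq_of_set_Some_iff)
      then show ?thesis using x True by simp
    next
      case False
      then have "sq_of_set (T - {k}) n = None"
        using fin cardT assms(1) by (simp add: sq_of_set_None_iff)
      moreover have "sq_of_set T n = None" if "n \<noteq> m"
        using that False fin cardT by (simp add: sq_of_set_None_iff)
      ultimately show ?thesis by simp
    qed
  qed
  then have "sq_map f (sq_of_set (T - {k})) = (sq_map f (sq_of_set T))(m := None)"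
    by (auto simp: sq_map_def)
  moreover have "sq_of_set T m = Some k" using assms(1) by (simp add: sq_of_set_Some_iff m_def)
  moreover have "sq_of_set T (Suc m) = None" using fin cardT by (simp add: sq_of_set_None_iff)
  ultimately show ?thesis unfolding drops_last_def by (auto simp: sq_map_def)
qed

text \<open>\<open>X l = Some (j, k)\<close> places the invocation made by \<open>j\<close> at time \<open>k\<close> at position \<open>l\<close>.\<close>

definition arrange :: "('p \<Rightarrow> nat \<Rightarrow> 'e) \<Rightarrow> (nat \<Rightarrow> ('p \<times> nat) option) \<Rightarrow> 'e sq" where
  "arrange g X = sq_map (\<lambda>l. case the (X l) of (j, k) \<Rightarrow> g j k) (sq_of_set {l. X l \<noteq> None})"

lemma arrange_Some:
  assumes "X l = Some (j, k)"
  shows "arrange g X (card {x. X x \<noteq> None \<and> x < l}) = Some (g j k)"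
proof -
  have "sq_of_set {l. X l \<noteq> None} (card {x. X x \<noteq> None \<and> x < l}) = Some l"
    unfolding sq_of_set_Some_iff using assms by auto
  then show ?thesis unfolding arrange_def sq_map_def using assms by auto
qed

lemma arrange_SomeE:
  assumes "arrange g X m = Some e"
  obtains l j k where "X l = Some (j, k)" "m = card {x. X x \<noteq> None \<and> x < l}" "e = g j k"
proof -
  obtain l where l: "sq_of_set {l. X l \<noteq> None} m = Some l" "e = (case the (X l) of (j, k) \<Rightarrow> g j k)"
    using assms unfolding arrange_def by (auto simp: sq_map_Some_iff)
  then obtain j k where "X l = Some (j, k)" unfolding sq_of_set_Some_iff by force
  then show ?thesis using l that[of l j k] unfolding sq_of_set_Some_iff by auto
qed

text \<open>Positions arise by composition: index \<open>m\<close> in the local history of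
  \<open>j\<close>, time of the invocation, slot \<open>at (j, m)\<close> of \<open>X\<close>, rank
  among the occupied slots. For fixed \<open>j\<close> every stage is increasing, so gaps in
  \<open>X\<close> do no harm.\<close>

lemma serialization_arrange:
  assumes surj: "\<And>j k. k \<in> J j \<longleftrightarrow> (\<exists>l. X l = Some (j, k))"
    and mono: "\<And>l l' j k k'. \<lbrakk>l < l'; X l = Some (j, k); X l' = Some (j, k')\<rbrakk> \<Longrightarrow> k < k'"
  shows "serialization (arrange g X) (\<lambda>j. sq_map (g j) (sq_of_set (J j)))"
proof -
  define T where "T = {l. X l \<noteq> None}"
  define H where "H = (\<lambda>j. sq_map (g j) (sq_of_set (J j)))"
  define at where "at = (\<lambda>(j, m). THE l. \<exists>k. X l = Some (j, k) \<and> sq_of_set (J j) m = Some k)"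
  define pos where "pos x = card {y \<in> T. y < at x}" for x
  \<comment> \<open>With \<open>k' = k\<close> the premise \<open>mono\<close> would give
    \<open>k < k\<close>, so no invocation occupies two slots.\<close>
  have inj: "l = l'" if "X l = Some (j, k)" "X l' = Some (j, k)" for l l' j k
    using mono[of l l' j k k] mono[of l' l j k k] that by (cases l l' rule: linorder_cases) auto
  have le: "l < l'" if "X l = Some (j, k)" "X l' = Some (j, k')" "k < k'" for l l' j k k'
    using mono[of l' l j k' k] that by (cases l l' rule: linorder_cases) auto
  have at: "X (at (j, m)) = Some (j, k)" if m: "sq_of_set (J j) m = Some k" for j m k
  proof -
    obtain l where l: "X l = Some (j, k)" using m surj[of k j] unfolding sq_of_set_Some_iff by blast
    have "at (j, m) = l" unfolding at_def prod.case
    proof (rule the_equality)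
      show "\<exists>k. X l = Some (j, k) \<and> sq_of_set (J j) m = Some k" using l m by blast
      show "l' = l" if "\<exists>k. X l' = Some (j, k) \<and> sq_of_set (J j) m = Some k" for l'
        using that l m by (intro inj[of l' j k l]) auto
    qed
    then show ?thesis using l by simp
  qed
  have dom: "H j m \<noteq> None \<longleftrightarrow> (\<exists>k. sq_of_set (J j) m = Some k)" for j m
    unfolding H_def by (auto simp: sq_map_None_iff)
  have atT: "at (j, m) \<in> T" if "H j m \<noteq> None" for j m
    using that dom at unfolding T_def by blast
  have arr: "arrange g X = sq_map (\<lambda>l. case the (X l) of (j, k) \<Rightarrow> g j k) (sq_of_set T)"
    unfolding arrange_def T_def ..
  have "bij_betw pos {(j, m). H j m \<noteq> None} {n. arrange g X n \<noteq> None}"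
    unfolding bij_betw_def
  proof
    show "inj_on pos {(j, m). H j m \<noteq> None}"
    proof (rule inj_onI)
      fix x y
      assume "x \<in> {(j, m). H j m \<noteq> None}" "y \<in> {(j, m). H j m \<noteq> None}" and "pos x = pos y"
      then obtain j m j' m' where xy: "x = (j, m)" "y = (j', m')"
        and H: "H j m \<noteq> None" "H j' m' \<noteq> None" and eq: "pos (j, m) = pos (j', m')"
        by (cases x; cases y) auto
      then obtain k k' where k: "sq_of_set (J j) m = Some k" "sq_of_set (J j') m' = Some k'"
        using dom by blast
      have "at (j, m) = at (j', m')" using eq H atT card_below_inj[of _ T] unfolding pos_def by blast
      then have "j = j' \<and> k = k'" using at[OF k(1)] at[OF k(2)] by simp
      then show "x = y" using k unfolding xy by (auto simp: sq_of_set_Some_iff)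
    qed
    show "pos ` {(j, m). H j m \<noteq> None} = {n. arrange g X n \<noteq> None}"
    proof (intro equalityI subsetI)
      fix n assume "n \<in> pos ` {(j, m). H j m \<noteq> None}"
      then obtain j m where "H j m \<noteq> None" and n: "n = pos (j, m)" by fast
      then obtain k where "sq_of_set (J j) m = Some k" using dom by blast
      then have "X (at (j, m)) = Some (j, k)" by (rule at)
      then show "n \<in> {n. arrange g X n \<noteq> None}"
        using arrange_Some[of X "at (j, m)" j k g] unfolding n pos_def T_def by (cases "g j k") simp
    next
      fix n assume "n \<in> {n. arrange g X n \<noteq> None}"
      then obtain e where "arrange g X n = Some e" by blast
      then obtain l j k where l: "X l = Some (j, k)" "n = card {x. X x \<noteq> None \<and> x < l}"
        by (rule arrange_SomeE)
      then have "k \<in> J j" using surj by blast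
      then have m: "sq_of_set (J j) (card {x \<in> J j. x < k}) = Some k" by (simp add: sq_of_set_Some_iff)
      then have "at (j, card {x \<in> J j. x < k}) = l" using at l inj by blast
      then have "n = pos (j, card {x \<in> J j. x < k})" unfolding pos_def T_def using l by simp
      moreover have "H j (card {x \<in> J j. x < k}) \<noteq> None" using m dom by blast
      ultimately show "n \<in> pos ` {(j, m). H j m \<noteq> None}" by blast
    qed
  qed
  moreover have "arrange g X (pos (j, m)) = H j m" if H: "H j m \<noteq> None" for j m
  proof -
    obtain k where k: "sq_of_set (J j) m = Some k" using H dom by blast
    then show ?thesis using at[OF k] arrange_Some[of X "at (j, m)" j k g]
      unfolding pos_def T_def H_def by (simp add: sq_map_def)
  qed
  moreover have "pos (j, m) < pos (j, m')" if less: "m < m'" "H j m' \<noteq> None" for j m m'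
  proof -
    obtain k' where k': "sq_of_set (J j) m' = Some k'" using less dom by blast
    then obtain k where k: "sq_of_set (J j) m = Some k"
      using less by (cases "sq_of_set (J j) m") (auto simp: sq_of_set_def split: if_splits)
    have "k < k'"
    proof (rule ccontr)
      assume "\<not> k < k'"
      then have "{x \<in> J j. x < k'} \<subseteq> {x \<in> J j. x < k}" by auto
      then have "m' \<le> m" using k k' card_mono[of "{x \<in> J j. x < k}" "{x \<in> J j. x < k'}"]
        by (auto simp: sq_of_set_Some_iff)
      then show False using less by simp
    qed
    then have "at (j, m) < at (j, m')" using at k k' le by blast
    moreover have "at (j, m) \<in> T" using atT k dom by blast
    ultimately show ?thesis unfolding pos_def using card_below_less by blast
  qed
  ultimately have "serialization (arrange g X) H"
    unfolding serialization_def by (intro conjI exI[of _ pos] allI impI) (auto simp: arr is_sq_sq_map is_sq_sq_of_set)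
  then show ?thesis unfolding H_def .
qed

section \<open>Update words and legality of arranged sequences\<close>

definition update_letters :: "('a, 'p, 'v) invocation \<Rightarrow> 'a list" where
  "update_letters e = (case e of (Update a, _, _) \<Rightarrow> [a] | _ \<Rightarrow> [])"

text \<open>The cut \<open>l\<close> is a slot of \<open>X\<close>, gaps included, so that legality
  can be argued along the time axis of a view rather than along compressed positions.\<close>

definition arranged_updates ::
  "('p \<Rightarrow> nat \<Rightarrow> ('a, 'p, 'v) invocation) \<Rightarrow> (nat \<Rightarrow> ('p \<times> nat) option) \<Rightarrow> nat \<Rightarrow> 'a list" where
  "arranged_updates g X l =
     concat (map (\<lambda>l. case X l of Some (j, k) \<Rightarrow> update_letters (g j k) | None \<Rightarrow> []) [0..<l])"

lemma updates_before_Suc: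
  "updates_before S (Suc m) =
     updates_before S m @ (case S m of Some e \<Rightarrow> update_letters e | None \<Rightarrow> [])"
  unfolding updates_before_def update_letters_def by (simp split: option.split prod.split oper.split)

lemma updates_before_arrange_at:
  "updates_before (arrange g X) (card {x. X x \<noteq> None \<and> x < l}) = arranged_updates g X l"
proof (induction l)
  case 0
  then show ?case by (simp add: updates_before_def arranged_updates_def)
next
  case (Suc l)
  show ?case
  proof (cases "X l")
    case None
    then have "{x. X x \<noteq> None \<and> x < Suc l} = {x. X x \<noteq> None \<and> x < l}"
      by (auto simp: less_Suc_eq)
    then show ?thesis using Suc None by (simp add: arranged_updates_def)
  next
    case (Some jk)
    then have "{x. X x \<noteq> None \<and> x < Suc l} = insert l {x. X x \<noteq> None \<and> x < l}"
      by (auto simp: less_Suc_eq)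
    then have card: "card {x. X x \<noteq> None \<and> x < Suc l} = Suc (card {x. X x \<noteq> None \<and> x < l})"
      by simp
    obtain j k where "jk = (j, k)" by (cases jk)
    then show ?thesis unfolding card updates_before_Suc
      using Suc Some arrange_Some[of X l j k g] by (simp add: arranged_updates_def)
  qed
qed

text \<open>Legality quantifies over all positions, including those past the end of a finite
  sequence. The prefix no longer grows there, so checking the cuts at slots is enough.\<close>

lemma updates_before_arrange:
  "\<exists>l. updates_before (arrange g X) m = arranged_updates g X l"
proof (induction m)
  case 0
  then show ?case by (intro exI[of _ 0]) (simp add: updates_before_def arranged_updates_def)
next
  case (Suc m)
  show ?case
  proof (cases "arrange g X m")
    case None
    then show ?thesis using Suc by (simp add: updates_before_Suc)
  next
    case (Some e)
    then obtain l j k where l: "X l = Some (j, k)" "m = card {x. X x \<noteq> None \<and> x < l}"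
      by (elim arrange_SomeE)
    have "{x. X x \<noteq> None \<and> x < Suc l} = insert l {x. X x \<noteq> None \<and> x < l}"
      using l by (auto simp: less_Suc_eq)
    then have "Suc m = card {x. X x \<noteq> None \<and> x < Suc l}" using l by simp
    then show ?thesis using updates_before_arrange_at by metis
  qed
qed

lemma pco_legal_arrange:
  assumes auth: "\<And>l j k op val p. \<lbrakk>X l = Some (j, k); g j k = (op, val, p)\<rbrakk> \<Longrightarrow> op \<in> authorized P p"
    and legal: "\<And>l. trace_of P (arranged_updates g X l) \<in> lang P"
    and qry: "\<And>l j k q val p. \<lbrakk>X l = Some (j, k); g j k = (Query q, val, p)\<rbrakk>
        \<Longrightarrow> val = Some (q (trace_of P (arranged_updates g X l)))"
    and upd: "\<And>l j k a v p. \<lbrakk>X l = Some (j, k); g j k = (Update a, Some v, p)\<rbrakk>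
        \<Longrightarrow> v = out a (trace_of P (arranged_updates g X l))"
  shows "pco_legal P out (arrange g X)"
proof -
  have at: "\<exists>l j k. X l = Some (j, k) \<and> g j k = e \<and>
      updates_before (arrange g X) m = arranged_updates g X l"
    if m: "arrange g X m = Some e" for m e
  proof -
    obtain l j k where "X l = Some (j, k)" "m = card {x. X x \<noteq> None \<and> x < l}" "e = g j k"
      by (rule arrange_SomeE[OF m])
    then show ?thesis using updates_before_arrange_at by blast
  qed
  have "op \<in> authorized P p" if "arrange g X m = Some (op, val, p)" for m op val p
    using at[OF that] auth by blast
  moreover have "trace_of P (updates_before (arrange g X) m) \<in> lang P" for m
    using updates_before_arrange[of g X m] legal by auto
  moreover have "val = Some (q (trace_of P (updates_before (arrange g X) m)))"
    if "arrange g X m = Some (Query q, val, p)" for m q val p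
    using at[OF that] qry by auto
  moreover have "val = Some (out a (trace_of P (updates_before (arrange g X) m)))"
    if m: "arrange g X m = Some (Update a, val, p)" and val: "val \<noteq> None" for m a val p
  proof -
    obtain v where "val = Some v" using val by auto
    then show ?thesis using at[OF m] upd by auto
  qed
  ultimately show ?thesis unfolding pco_legal_def by blast
qed

section \<open>Traces and the diamond closure\<close>

abbreviation commute :: "('a, 'p, 'v) pco \<Rightarrow> 'a list \<Rightarrow> 'a list \<Rightarrow> bool" where
  "commute P \<equiv> (swap (indep P))\<^sup>*\<^sup>*"

lemma sym_swap_indep: "swap (indep P) u v \<Longrightarrow> swap (indep P) v u"
proof (induction rule: swap.induct)
  case (1 a b x y)
  then have "(b, a) \<in> indep P" by (auto simp: indep_def)
  then show ?case by (rule swap.intros)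
qed

lemma commute_sym: "commute P u v \<Longrightarrow> commute P v u"
  by (induction rule: rtranclp_induct) (auto intro: converse_rtranclp_into_rtranclp sym_swap_indep)

lemma commute_append_context:
  assumes "commute P u v"
  shows "commute P (x @ u @ y) (x @ v @ y)"
  using assms
proof (induction rule: rtranclp_induct)
  case (step v w)
  from step(2) have "swap (indep P) (x @ v @ y) (x @ w @ y)"
  proof cases
    case (1 a b x' y')
    then show ?thesis using swap.intros[of a b "indep P" "x @ x'" "y' @ y"] by simp
  qed
  then show ?case using step(3) by simp
qed simp

lemma commute_append:
  assumes "commute P u u'" "commute P v v'"
  shows "commute P (u @ v) (u' @ v')"
  using commute_append_context[OF assms(1), of "[]" v] commute_append_context[OF assms(2), of u' "[]"]
  by simp

lemma trace_of_eqI: "commute P u v \<Longrightarrow> trace_of P u = trace_of P v"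
  unfolding trace_of_def by (auto intro: rtranclp_trans commute_sym)

text \<open>Commutation is a congruence, so all representatives in the union yield the same class.
  This turns the axioms in \<open>pco_spec\<close> into statements about words.\<close>

lemma tconcat_trace_of: "tconcat P (trace_of P u) (trace_of P v) = trace_of P (u @ v)"
proof -
  have "trace_of P (u' @ v') = trace_of P (u @ v)" if "u' \<in> trace_of P u" "v' \<in> trace_of P v" for u' v'
    using that by (intro trace_of_eqI[symmetric] commute_append) (auto simp: trace_of_def)
  moreover have "u \<in> trace_of P u" "v \<in> trace_of P v" unfolding trace_of_def by auto
  ultimately show ?thesis unfolding tconcat_def by blast
qed

lemma pco_spec_common:
  assumes "pco_spec P" "trace_of P u \<in> lang P" "a \<in> common P"
  shows "trace_of P (u @ [a]) \<in> lang P"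
proof -
  have "trace_of P [a] \<in> traces P (common P)" using assms unfolding traces_def by auto
  then have "tconcat P (trace_of P u) (trace_of P [a]) \<in> lang P"
    using assms unfolding pco_spec_def by blast
  then show ?thesis by (simp add: tconcat_trace_of)
qed

lemma pco_spec_diamond:
  assumes "pco_spec P" "trace_of P u \<in> lang P" "a \<in> own P i"
    and "set z \<subseteq> updates P - own P i"
    and "trace_of P (u @ [a]) \<in> lang P" "trace_of P (u @ z) \<in> lang P"
  shows "trace_of P (u @ z @ [a]) \<in> lang P"
proof -
  have "trace_of P z \<in> traces P (updates P - own P i)" using assms unfolding traces_def by auto
  then have "tconcat P (trace_of P u) (trace_of P [a]) \<in> lang P \<and>
      tconcat P (trace_of P u) (trace_of P z) \<in> lang P \<longrightarrow>
    tconcat P (tconcat P (trace_of P u) (trace_of P z)) (trace_of P [a]) \<in> lang P"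
    using assms(1-3) unfolding pco_spec_def by blast
  then show ?thesis using assms(5,6) by (simp add: tconcat_trace_of)
qed

text \<open>A word of pairs \<open>(j, a)\<close> records for every update \<open>a\<close> the process \<open>j\<close> that issued it.\<close>

definition issued :: "('a, 'p, 'v) pco \<Rightarrow> ('p \<times> 'a) list \<Rightarrow> bool" where
  "issued P W \<longleftrightarrow> (\<forall>(j, a) \<in> set W. a \<in> common P \<union> own P j)"

abbreviation project :: "'p \<Rightarrow> ('p \<times> 'a) list \<Rightarrow> ('p \<times> 'a) list" where
  "project j W \<equiv> filter (\<lambda>x. fst x = j) W"

lemma issued_owner:
  assumes "pco_spec P" "a \<in> common P \<union> own P i" "a \<in> own P j"
  shows "i = j"
proof -
  have "common P \<inter> own P j = {}" "i \<noteq> j \<longrightarrow> own P i \<inter> own P j = {}"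
    using assms(1) unfolding pco_spec_def by blast+
  then show ?thesis using assms(2,3) by auto
qed

text \<open>Dependence would put both letters into one set \<open>own P k\<close>, and exclusivity
  would force \<open>i = k = j\<close>.\<close>

lemma indep_issued:
  assumes "pco_spec P" "a \<in> common P \<union> own P i" "b \<in> common P \<union> own P j" "i \<noteq> j"
  shows "(a, b) \<in> indep P"
proof -
  have "\<not> (a \<in> own P k \<and> b \<in> own P k)" for k
    using issued_owner[OF assms(1), of a i k] issued_owner[OF assms(1), of b j k] assms(2-4) by auto
  then show ?thesis using assms(2,3) unfolding indep_def updates_def by auto
qed

lemma commute_to_front:
  assumes "pco_spec P" "issued P W" "b \<in> common P \<union> own P j" "project j W = []"
  shows "commute P (map snd W @ [b]) (b # map snd W)"
  using assms(2,4)
proof (induction W)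
  case (Cons x W)
  obtain i a where x: "x = (i, a)" by (cases x)
  have "commute P (map snd W @ [b]) (b # map snd W)"
    using Cons by (auto simp: issued_def split: if_splits)
  then have "commute P (map snd (x # W) @ [b]) ([a] @ (b # map snd W))"
    using commute_append_context[of P _ _ "[a]" "[]"] x by fastforce
  moreover have "(a, b) \<in> indep P"
    using Cons.prems x by (intro indep_issued[OF assms(1) _ assms(3)]) (auto simp: issued_def split: if_splits)
  then have "swap (indep P) ([] @ [a, b] @ map snd W) ([] @ [b, a] @ map snd W)"
    by (rule swap.intros)
  ultimately show ?case using x by simp
qed simp

text \<open>A projection property of traces: letters of different issuers commute, so the
  projections to single issuers decide. The letters of \<open>B\<close> are moved to the front of
  \<open>U\<close> one by one; nothing issued by the same process stands before the first occurrence
  of the next one.\<close>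

lemma commute_prefix:
  assumes "pco_spec P" "issued P U" "\<And>j. \<exists>Z. project j U = project j B @ Z"
  shows "\<exists>Z. issued P Z \<and> commute P (map snd U) (map snd B @ map snd Z) \<and>
    (\<forall>j. project j U = project j B @ project j Z)"
  using assms(2,3)
proof (induction B arbitrary: U)
  case Nil
  then show ?case by auto
next
  case (Cons x B)
  obtain j b where x: "x = (j, b)" by (cases x)
  obtain Z where Z: "project j U = x # project j B @ Z" using Cons.prems(2)[of j] x by auto
  then have "x \<in> set (project j U)" by simp
  then have "x \<in> set U" by simp
  then obtain U1 U2 where U: "U = U1 @ x # U2" "x \<notin> set U1" by (meson split_list_first)
  \<comment> \<open>The projection of \<open>U\<close> to \<open>j\<close> starts with
    \<open>x\<close>, so the first update of \<open>j\<close> in \<open>U1\<close> would be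
    \<open>x\<close> itself, which \<open>U1\<close> does not contain.\<close>
  have U1: "project j U1 = []"
  proof (cases "project j U1")
    case (Cons y ys)
    then have "y = x" using Z U by simp
    moreover have "y \<in> set (project j U1)" using Cons by simp
    ultimately show ?thesis using U(2) by simp
  qed
  have iss: "issued P (U1 @ U2)" "issued P U1" "b \<in> common P \<union> own P j"
    using Cons.prems(1) U x by (auto simp: issued_def)
  have proj: "project i U = (if i = j then [x] else []) @ project i (U1 @ U2)" for i
    using U U1 x by auto
  have "\<exists>Z. project i (U1 @ U2) = project i B @ Z" for i
    using Cons.prems(2)[of i] proj[of i] x by (auto split: if_splits)
  then obtain Z' where Z': "issued P Z'"
      "commute P (map snd (U1 @ U2)) (map snd B @ map snd Z')"
      "\<And>i. project i (U1 @ U2) = project i B @ project i Z'"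
    using Cons.IH[OF iss(1)] by blast
  have "commute P ((map snd U1 @ [b]) @ map snd U2) ((b # map snd U1) @ map snd U2)"
    by (intro commute_append commute_to_front[OF assms(1) iss(2,3) U1]) simp
  then have "commute P (map snd U) ([b] @ map snd (U1 @ U2))" using U x by simp
  moreover have "commute P ([b] @ map snd (U1 @ U2)) ([b] @ map snd B @ map snd Z')"
    by (intro commute_append Z'(2)) simp
  ultimately have "commute P (map snd U) (map snd (x # B) @ map snd Z')"
    using x by (auto intro: rtranclp_trans)
  moreover have "\<forall>i. project i U = project i (x # B) @ project i Z'"
    using proj Z'(3) x by auto
  ultimately show ?case using Z'(1) by blast
qed

text \<open>Up to commutation \<open>U\<close> is \<open>B\<close> followed by updates that were not issued by \<open>j\<close>, so the diamond
  closure applies.\<close>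

lemma lang_extend:
  assumes spec: "pco_spec P" and "issued P U" and pre: "\<And>i. \<exists>Z. project i U = project i B @ Z"
    and eq: "project j U = project j B" and a: "a \<in> common P \<union> own P j"
    and B: "trace_of P (map snd B) \<in> lang P" "trace_of P (map snd B @ [a]) \<in> lang P"
    and U: "trace_of P (map snd U) \<in> lang P"
  shows "trace_of P (map snd U @ [a]) \<in> lang P"
proof (cases "a \<in> common P")
  case True
  then show ?thesis using pco_spec_common[OF spec U] by simp
next
  case False
  then have own: "a \<in> own P j" using a by simp
  obtain Z where Z: "issued P Z" "commute P (map snd U) (map snd B @ map snd Z)"
      "\<And>i. project i U = project i B @ project i Z"
    using commute_prefix[OF spec assms(2) pre] by blast
  have "project j Z = []" using Z(3)[of j] eq by simp
  then have "\<forall>(i, b) \<in> set Z. i \<noteq> j" by (auto simp: filter_empty_conv)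
  \<comment> \<open>A letter of \<open>own P j\<close> can only be issued by \<open>j\<close>, and
    nothing in \<open>Z\<close> is.\<close>
  then have "set (map snd Z) \<subseteq> updates P - own P j"
    using Z(1) issued_owner[OF spec, of _ _ j] unfolding issued_def updates_def by fastforce
  moreover have "trace_of P (map snd B @ map snd Z) \<in> lang P" using U trace_of_eqI[OF Z(2)] by simp
  ultimately have "trace_of P (map snd B @ map snd Z @ [a]) \<in> lang P"
    using pco_spec_diamond[OF spec B(1) own _ B(2)] by blast
  moreover have "commute P (map snd U @ [a]) ((map snd B @ map snd Z) @ [a])"
    by (intro commute_append Z(2)) simp
  ultimately show ?thesis using trace_of_eqI by fastforce
qed

section \<open>Invariants of executions\<close>

fun actor :: "('a, 'p, 'v) event \<Rightarrow> 'p option" where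
  "actor (Invoke i op) = Some i"
| "actor (Return i op v) = Some i"
| "actor (Abort i a) = Some i"
| "actor (RBroadcast i sn a) = Some i"
| "actor (RDeliver i j sn a) = Some i"
| "actor (Apply i j sn a) = Some i"
| "actor (Crash i) = Some i"
| "actor Stutter = None"

lemma lstep_actor: "lstep P out i s e s' \<Longrightarrow> actor e = Some i"
  by (induction rule: lstep.induct) auto

inductive_simps lstep_Invoke: "lstep P out i s (Invoke i' op) s'"
inductive_simps lstep_Return: "lstep P out i s (Return i' op v) s'"
inductive_simps lstep_RBroadcast: "lstep P out i s (RBroadcast i' sn a) s'"
inductive_simps lstep_RDeliver: "lstep P out i s (RDeliver i' j sn a) s'"
inductive_simps lstep_Apply: "lstep P out i s (Apply i' j sn a) s'"

lemma enabled_iff: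
  assumes "actor e = Some i"
  shows "enabled P out g e \<longleftrightarrow> (\<exists>s'. lstep P out i (g i) e s')"
  using assms lstep_actor[of P out _ _ e] unfolding enabled_def gstep_def by fastforce

locale pco_execution =
  fixes P :: "('a, 'p::finite, 'v) pco"
    and out :: "'a \<Rightarrow> 'a trace \<Rightarrow> 'v"
    and t :: nat
    and st :: "nat \<Rightarrow> 'p \<Rightarrow> ('a, 'p, 'v) lstate"
    and ev :: "nat \<Rightarrow> ('a, 'p, 'v) event"
  assumes spec: "pco_spec P"
    and exec: "execution P out t st ev"
begin

lemma init: "st 0 i = init_lstate"
  using exec unfolding execution_def by blast

lemma own_step: "actor (ev k) = Some i \<Longrightarrow> lstep P out i (st k i) (ev k) (st (Suc k) i)"
  and other_step: "actor (ev k) \<noteq> Some i \<Longrightarrow> st (Suc k) i = st k i"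
proof -
  have "gstep P out (st k) (ev k) (st (Suc k))" using exec unfolding execution_def by blast
  then consider "ev k = Stutter" "st (Suc k) = st k"
    | j s' where "lstep P out j (st k j) (ev k) s'" "st (Suc k) = (st k)(j := s')"
    unfolding gstep_def by blast
  note c = this
  show "lstep P out i (st k i) (ev k) (st (Suc k) i)" if "actor (ev k) = Some i"
    using that by (cases rule: c) (auto dest: lstep_actor)
  show "st (Suc k) i = st k i" if "actor (ev k) \<noteq> Some i"
    using that by (cases rule: c) (auto dest: lstep_actor)
qed

lemma step_cases:
  obtains (own) "actor (ev k) = Some i" "lstep P out i (st k i) (ev k) (st (Suc k) i)"
  | (other) "actor (ev k) \<noteq> Some i" "st (Suc k) i = st k i"
  using own_step other_step by blast

lemma Invoke_step: "ev k = Invoke i op \<Longrightarrow> lstep P out i (st k i) (Invoke i op) (st (Suc k) i)"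
  using own_step[of k i] by simp

lemma Return_step: "ev k = Return i op v \<Longrightarrow> lstep P out i (st k i) (Return i op v) (st (Suc k) i)"
  using own_step[of k i] by simp

lemma RBroadcast_step:
  "ev k = RBroadcast i sn a \<Longrightarrow> lstep P out i (st k i) (RBroadcast i sn a) (st (Suc k) i)"
  using own_step[of k i] by simp

lemma Apply_step:
  "ev k = Apply i j sn a \<Longrightarrow> lstep P out i (st k i) (Apply i j sn a) (st (Suc k) i)"
  using own_step[of k i] by simp

lemma alive_Suc: "alive (st (Suc k) i) \<Longrightarrow> alive (st k i)"
  by (cases rule: step_cases[of k i]) (auto elim: lstep.cases)

lemma alive_antimono: "k \<le> l \<Longrightarrow> alive (st l i) \<Longrightarrow> alive (st k i)"
  by (induction l rule: dec_induct) (auto dest: alive_Suc)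

lemma alive_step: "actor (ev k) = Some i \<Longrightarrow> alive (st k i)"
  using own_step by (auto elim: lstep.cases)

lemma local_sn_Suc: "local_sn (st k i) \<le> local_sn (st (Suc k) i)"
  by (cases rule: step_cases[of k i]) (auto elim: lstep.cases)

lemma local_sn_mono: "k \<le> l \<Longrightarrow> local_sn (st k i) \<le> local_sn (st l i)"
  using lift_Suc_mono_le[of "\<lambda>k. local_sn (st k i)"] local_sn_Suc by blast

lemma local_del_Suc: "local_del (st k i) j \<le> local_del (st (Suc k) i) j"
  by (cases rule: step_cases[of k i]) (auto elim!: lstep.cases)

lemma local_del_mono: "k \<le> l \<Longrightarrow> local_del (st k i) j \<le> local_del (st l i) j"
  using lift_Suc_mono_le[of "\<lambda>k. local_del (st k i) j"] local_del_Suc by blast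

lemma local_seq_lang: "trace_of P (local_seq (st k i)) \<in> lang P"
proof (induction k)
  case 0
  then show ?case using spec unfolding pco_spec_def by (simp add: init init_lstate_def)
next
  case (Suc k)
  then show ?case by (cases rule: step_cases[of k i]) (auto elim: lstep.cases)
qed

subsection \<open>Messages\<close>

lemma crb: "cr_broadcast (faulty_set st)
    (\<lambda>k j sn a. ev k = RBroadcast j sn a) (\<lambda>k i j sn a. ev k = RDeliver i j sn a)"
  using exec unfolding execution_def by blast

lemma delivered_broadcast: "ev k = RDeliver i j sn a \<Longrightarrow> \<exists>b<k. ev b = RBroadcast j sn a"
  using crb[unfolded cr_broadcast_def, THEN conjunct1] by blast

lemma RBroadcast_sn:
  assumes "ev b = RBroadcast j sn a"
  shows "phase (st b j) = Accepted a" "sn = Suc (local_sn (st b j))" "local_sn (st (Suc b) j) = sn"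
  using RBroadcast_step[OF assms] by (auto simp: lstep_RBroadcast)

text \<open>Each broadcast increases \<open>local_sn\<close>, so the number determines the time of
  the broadcast and with it the message.\<close>

lemma RBroadcast_unique:
  assumes "ev b = RBroadcast j sn a" "ev b' = RBroadcast j sn a'"
  shows "b = b' \<and> a = a'"
proof -
  have "b = b'"
    using RBroadcast_sn[OF assms(1)] RBroadcast_sn[OF assms(2)]
      local_sn_mono[of "Suc b" b' j] local_sn_mono[of "Suc b'" b j]
    by (cases b b' rule: linorder_cases) auto
  then show ?thesis using assms by simp
qed

lemma waiting_delivered:
  "(j, sn, a) \<in> waiting_msgs (st l i) \<Longrightarrow> \<exists>l'<l. ev l' = RDeliver i j sn a"
proof (induction l)
  case 0
  then show ?case by (simp add: init init_lstate_def)
next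
  case (Suc l)
  have "(j, sn, a) \<in> waiting_msgs (st l i) \<or> ev l = RDeliver i j sn a"
    using Suc.prems by (cases rule: step_cases[of l i]) (auto elim: lstep.cases)
  then show ?case using Suc.IH less_Suc_eq by blast
qed

lemma delivered_waiting:
  assumes "ev l' = RDeliver i j sn a" "l' < l" "\<And>m. m < l \<Longrightarrow> ev m \<noteq> Apply i j sn a"
  shows "(j, sn, a) \<in> waiting_msgs (st l i)"
proof -
  have "Suc l' \<le> l" using assms(2) by simp
  then show ?thesis using assms(3)
  proof (induction l rule: dec_induct)
    case base
    then show ?case using own_step[of l' i] assms(1) by (auto simp: lstep_RDeliver)
  next
    case (step l)
    then have "(j, sn, a) \<in> waiting_msgs (st l i)" "ev l \<noteq> Apply i j sn a" by auto
    then show ?case by (cases rule: step_cases[of l i]) (auto elim: lstep.cases)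
  qed
qed

lemma Apply_facts:
  assumes "ev l = Apply i j sn a"
  shows "sn = Suc (local_del (st l i) j)" "a \<in> common P \<union> own P j"
    "local_del (st (Suc l) i) = (local_del (st l i))(j := sn)"
    "local_seq (st (Suc l) i) = local_seq (st l i) @ [a]"
    "\<exists>l'<l. ev l' = RDeliver i j sn a" "\<exists>b<l. ev b = RBroadcast j sn a"
proof -
  show *: "\<exists>l'<l. ev l' = RDeliver i j sn a"
    using Apply_step[OF assms] waiting_delivered by (auto simp: lstep_Apply)
  show "\<exists>b<l. ev b = RBroadcast j sn a"
    using * delivered_broadcast less_trans by blast
qed (use Apply_step[OF assms] in \<open>auto simp: lstep_Apply\<close>)

lemma not_Apply_facts:
  assumes "\<And>j sn a. ev l \<noteq> Apply i j sn a"
  shows "local_del (st (Suc l) i) = local_del (st l i)" "local_seq (st (Suc l) i) = local_seq (st l i)"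
proof -
  have "local_del (st (Suc l) i) = local_del (st l i) \<and> local_seq (st (Suc l) i) = local_seq (st l i)"
  proof (cases rule: step_cases[of l i])
    case own
    from own(2) show ?thesis by cases (use assms in auto)
  qed simp
  then show "local_del (st (Suc l) i) = local_del (st l i)"
    "local_seq (st (Suc l) i) = local_seq (st l i)" by auto
qed

lemma Apply_local_del: "ev l' = Apply i j sn a \<Longrightarrow> l' < l \<Longrightarrow> sn \<le> local_del (st l i) j"
  using local_del_mono[of "Suc l'" l i j] Apply_facts(3)[of l' i j sn a] by simp

text \<open>A message is processed only if its number is the successor of the counter, so the
  counter skips no value: it is both a count and the highest number processed.\<close>

lemma local_del_Apply:
  "1 \<le> sn \<Longrightarrow> sn \<le> local_del (st l i) j \<Longrightarrow> \<exists>l'<l. \<exists>a. ev l' = Apply i j sn a"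
proof (induction l)
  case 0
  then show ?case by (simp add: init init_lstate_def)
next
  case (Suc l)
  show ?case
  proof (cases "sn \<le> local_del (st l i) j")
    case True
    then show ?thesis using Suc less_Suc_eq by blast
  next
    case False
    then obtain j' sn' a' where ap: "ev l = Apply i j' sn' a'"
      using not_Apply_facts(1) Suc.prems by metis
    have "sn = sn'" "j = j'"
      using Apply_facts(1,3)[OF ap] False Suc.prems by (auto split: if_splits)
    then show ?thesis using ap by auto
  qed
qed

lemma own_local_del_le: "local_del (st l i) i \<le> local_sn (st l i)"
proof (cases "local_del (st l i) i")
  case (Suc n)
  then obtain l' a where l': "l' < l" "ev l' = Apply i i (Suc n) a"
    using local_del_Apply[of "Suc n" l i i] by auto
  then obtain b where "b < l'" "ev b = RBroadcast i (Suc n) a" using Apply_facts(6) by blast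
  then show ?thesis using RBroadcast_sn(3)[of b i "Suc n" a] local_sn_mono[of "Suc b" l i] l' Suc by simp
qed simp

text \<open>An update leaves \<open>Waiting\<close> only after its own message has been processed.
  Hence the test made at an invocation refers to a sequence that contains all earlier updates of the
  issuer.\<close>

lemma own_local_del_eq:
  "(\<And>a. phase (st l i) \<noteq> Waiting a) \<Longrightarrow> local_del (st l i) i = local_sn (st l i)"
proof (induction l)
  case 0
  then show ?case by (simp add: init init_lstate_def)
next
  case (Suc l)
  \<comment> \<open>Excludes that an own message is processed outside \<open>Waiting\<close>, which
    would push the counter above \<open>local_sn\<close>.\<close>
  have le: "local_del (st (Suc l) i) i \<le> local_sn (st (Suc l) i)" by (rule own_local_del_le)
  show ?case
  proof (cases rule: step_cases[of l i])
    case own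
    from own(2) show ?thesis
      by cases (use Suc le in \<open>auto split: if_splits\<close>)
  next
    case other
    then show ?thesis using Suc by simp
  qed
qed

subsection \<open>Pending operations\<close>

text \<open>Time \<open>l\<close> stands for the state before \<open>ev l\<close>, so an operation
  is still pending at the moment of its return. Crashes are not mentioned: an operation interrupted
  by one stays pending forever.\<close>

definition pending :: "'p \<Rightarrow> nat \<Rightarrow> nat \<Rightarrow> bool" where
  "pending i k l \<longleftrightarrow> k < l \<and> (\<exists>op. ev k = Invoke i op) \<and>
     (\<forall>l'. k < l' \<and> l' < l \<longrightarrow> (\<forall>op v. ev l' \<noteq> Return i op v))"

lemma pending_antimono: "pending i k l \<Longrightarrow> k < l' \<Longrightarrow> l' \<le> l \<Longrightarrow> pending i k l'"
  unfolding pending_def by auto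

lemma pending_start: "ev k = Invoke i op \<Longrightarrow> pending i k (Suc k)"
  unfolding pending_def by auto

lemma pending_SucI: "pending i k l \<Longrightarrow> (\<And>op v. ev l \<noteq> Return i op v) \<Longrightarrow> pending i k (Suc l)"
  unfolding pending_def by (auto simp: less_Suc_eq)

lemma pending_induct [consumes 1, case_names start step]:
  assumes "pending i k l"
    and "\<And>op. ev k = Invoke i op \<Longrightarrow> R (Suc k)"
    and "\<And>l. \<lbrakk>pending i k l; \<And>op v. ev l \<noteq> Return i op v; R l\<rbrakk> \<Longrightarrow> R (Suc l)"
  shows "R l"
proof -
  have "Suc k \<le> l" using assms(1) unfolding pending_def by simp
  then show ?thesis using assms(1)
  proof (induction l rule: dec_induct)
    case base
    then show ?case using assms(2) unfolding pending_def by blast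
  next
    case (step l)
    then have "pending i k l" "\<And>op v. ev l \<noteq> Return i op v" unfolding pending_def by auto
    then show ?case using step assms(3) by blast
  qed
qed

lemma Invoke_Query_phase:
  "ev k = Invoke i (Query q) \<Longrightarrow> phase (st k i) = Idle \<and> phase (st (Suc k) i) = Querying q"
  using Invoke_step[of k i "Query q"] by (auto simp: lstep_Invoke)

lemma Invoke_Update_facts:
  assumes "ev k = Invoke i (Update a)"
  shows "phase (st k i) = Idle" "st (Suc k) i = (st k i)\<lparr>phase := Accepted a\<rparr>"
    "a \<in> common P \<union> own P i" "trace_of P (local_seq (st k i) @ [a]) \<in> lang P"
    "local_del (st k i) i = local_sn (st k i)"
  using Invoke_step[OF assms] own_local_del_eq[of k i] by (auto simp: lstep_Invoke)

lemma Invoke_Idle: "ev k = Invoke i op \<Longrightarrow> phase (st k i) = Idle"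
  using Invoke_Query_phase Invoke_Update_facts(1) by (cases op) auto

lemma Invoke_authorized: "ev k = Invoke i op \<Longrightarrow> op \<in> authorized P i"
  using Invoke_step[of k i op] unfolding authorized_def by (cases op) (auto simp: lstep_Invoke)

lemma pending_query:
  assumes "pending i k l" "ev k = Invoke i (Query q)"
  shows "phase (st l i) = Querying q"
  using assms(1)
proof (induction rule: pending_induct)
  case start
  then show ?case using Invoke_Query_phase assms(2) by blast
next
  case (step l)
  show ?case
  proof (cases rule: step_cases[of l i])
    case own
    from own(2) show ?thesis by cases (use step in auto)
  next
    case other
    then show ?thesis using step by simp
  qed
qed

text \<open>Control point and own counter pass together through three stages: accepted, broadcast,
  processed. In the last one \<open>result\<close> keeps the value computed when the own message was
  applied, since messages of others leave it unchanged.\<close>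

lemma pending_update:
  assumes "pending i k l" and inv: "ev k = Invoke i (Update a)"
  defines "s \<equiv> local_sn (st k i)"
  shows "phase (st l i) = Accepted a \<and> local_sn (st l i) = s \<and> local_del (st l i) i = s \<or>
    phase (st l i) = Waiting a \<and> local_sn (st l i) = Suc s \<and>
    (\<exists>b. k < b \<and> b < l \<and> ev b = RBroadcast i (Suc s) a) \<and>
    (local_del (st l i) i = s \<or>
     local_del (st l i) i = Suc s \<and>
     (\<exists>l'. k < l' \<and> l' < l \<and> ev l' = Apply i i (Suc s) a \<and>
        result (st l i) = Some (out a (trace_of P (local_seq (st l' i))))))"
    (is "?A l \<or> ?W l \<and> ?N l \<and> ?B l \<and> (?D l \<or> ?E l \<and> ?R l)")
  using assms(1)
proof (induction rule: pending_induct)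
  case start
  then show ?case using Invoke_Update_facts[OF inv] by (simp add: s_def)
next
  case (step l)
  have kl: "k < l" using step(1) unfolding pending_def by simp
  show ?case
  proof (cases "\<exists>j sn b. ev l = Apply i j sn b")
    case True
    then obtain j sn b where ap: "ev l = Apply i j sn b" by blast
    have st': "phase (st (Suc l) i) = phase (st l i)" "local_sn (st (Suc l) i) = local_sn (st l i)"
      "result (st (Suc l) i) = (if j = i then Some (out b (trace_of P (local_seq (st l i)))) else result (st l i))"
      using Apply_step[OF ap] by (auto simp: lstep_Apply)
    note facts = Apply_facts[OF ap]
    have B: "?B l \<Longrightarrow> ?B (Suc l)" using less_Suc_eq by blast
    have R: "j \<noteq> i \<Longrightarrow> ?R l \<Longrightarrow> ?R (Suc l)" using less_Suc_eq st'(3) by auto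
    show ?thesis
    proof (cases "j = i")
      case False
      then have del: "local_del (st (Suc l) i) i = local_del (st l i) i" using facts(3) by simp
      show ?thesis using step(3) B R[OF False] unfolding st'(1,2) del by blast
    next
      case True
      obtain b' where b': "b' < l" "ev b' = RBroadcast i sn b" using facts(6) True by blast
      \<comment> \<open>The message has been broadcast, so \<open>sn\<close> is at most
        \<open>local_sn\<close>; as \<open>sn\<close> exceeds the own counter by one, only the stage
        between broadcast and processing remains.\<close>
      have "sn \<le> local_sn (st l i)" using RBroadcast_sn(3)[OF b'(2)] local_sn_mono[of "Suc b'" l i] b' by simp
      then have W: "?W l" "?N l" "?B l" "?D l" "sn = Suc s"
        using step(3) facts(1) True by auto
      then have "b = a" using RBroadcast_unique b'(2) by blast
      then have "?E (Suc l) \<and> ?R (Suc l)" using facts(3) True \<open>sn = Suc s\<close> ap kl st'(3) by auto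
      moreover have "?W (Suc l)" "?N (Suc l)" "?B (Suc l)" using W(1-3) B unfolding st'(1,2) by blast+
      ultimately show ?thesis by blast
    qed
  next
    case False
    have del: "local_del (st (Suc l) i) i = local_del (st l i) i" using False not_Apply_facts(1) by metis
    show ?thesis
    proof (cases rule: step_cases[of l i])
      case other
      then show ?thesis using step(3) less_Suc_eq by auto
    next
      case own
      show ?thesis
      proof (cases "\<exists>sn b. ev l = RBroadcast i sn b")
        case True
        then obtain sn b where br: "ev l = RBroadcast i sn b" by blast
        then have "phase (st l i) = Accepted b" "sn = Suc (local_sn (st l i))" "local_sn (st (Suc l) i) = sn"
            "phase (st (Suc l) i) = Waiting b"
          using RBroadcast_sn[OF br] RBroadcast_step[OF br] by (auto simp: lstep_RBroadcast)
        then show ?thesis using step(3) br kl del by auto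
      next
        case nb: False
        have "phase (st l i) \<noteq> Idle" using step(3) by auto
        from own(2) have "phase (st (Suc l) i) = phase (st l i) \<and>
            local_sn (st (Suc l) i) = local_sn (st l i) \<and> result (st (Suc l) i) = result (st l i)"
          by cases (use \<open>phase (st l i) \<noteq> Idle\<close> nb False step(2) in auto)
        then show ?thesis using step(3) del less_Suc_eq by auto
      qed
    qed
  qed
qed

lemma pending_not_Idle: "pending i k l \<Longrightarrow> phase (st l i) \<noteq> Idle"
proof -
  assume p: "pending i k l"
  then obtain op where "ev k = Invoke i op" unfolding pending_def by blast
  then show ?thesis using pending_query[OF p] pending_update[OF p] by (cases op) auto
qed

lemma pending_not_Invoke: "pending i k l \<Longrightarrow> ev l \<noteq> Invoke i op"
  using pending_not_Idle Invoke_Idle by blast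

lemma pending_no_Invoke_between: "pending i k l \<Longrightarrow> k < m \<Longrightarrow> m \<le> l \<Longrightarrow> ev m \<noteq> Invoke i op"
  using pending_not_Invoke pending_antimono by blast

lemma pending_unique:
  assumes "pending i k l" "pending i k' l"
  shows "k = k'"
proof (rule ccontr)
  assume "k \<noteq> k'"
  moreover have "k < l" "k' < l" "\<exists>op. ev k = Invoke i op" "\<exists>op. ev k' = Invoke i op"
    using assms unfolding pending_def by auto
  ultimately show False
    using pending_no_Invoke_between[OF assms(1), of k'] pending_no_Invoke_between[OF assms(2), of k]
    by (cases k k' rule: linorder_cases) auto
qed

lemma ex_pending: "phase (st l i) \<noteq> Idle \<Longrightarrow> \<exists>k. pending i k l"
proof (induction l)
  case 0
  then show ?case by (simp add: init init_lstate_def)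
next
  case (Suc l)
  show ?case
  proof (cases "phase (st l i) = Idle")
    case True
    then have "\<exists>op. ev l = Invoke i op"
      using Suc.prems by (cases rule: step_cases[of l i]) (auto elim: lstep.cases)
    then show ?thesis using pending_start by blast
  next
    case False
    then obtain k where "pending i k l" using Suc.IH by blast
    moreover have "ev l \<noteq> Return i op v" for op v
      using Suc.prems Return_step[of l i op v] by (auto simp: lstep_Return)
    ultimately show ?thesis using pending_SucI by blast
  qed
qed

lemma Return_pending:
  assumes "ev l = Return i op v"
  shows "\<exists>k. pending i k l \<and> ev k = Invoke i op"
proof -
  have "phase (st l i) \<noteq> Idle" using Return_step[OF assms] by (auto simp: lstep_Return)
  then obtain k where k: "pending i k l" using ex_pending by blast
  then obtain op' where op': "ev k = Invoke i op'" unfolding pending_def by blast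
  \<comment> \<open>The partial \<open>case\<close> terms merely name the argument of
    \<open>op'\<close>; each is used only in the branch where it is defined.\<close>
  have "op' = op"
    using pending_query[OF k, of "case op' of Query q \<Rightarrow> q"]
      pending_update[OF k, of "case op' of Update a \<Rightarrow> a"] op' Return_step[OF assms]
    by (cases op') (auto simp: lstep_Return)
  then show ?thesis using k op' by blast
qed

text \<open>\<open>returns\<close> excludes invocations in between, \<open>pending\<close> excludes
  returns in between. Invocations and returns of one process alternate, so the conditions
  agree.\<close>

lemma returns_iff:
  "returns ev i k op v \<longleftrightarrow> ev k = Invoke i op \<and> (\<exists>l. pending i k l \<and> ev l = Return i op v)"
proof
  assume "returns ev i k op v"
  then obtain l where l: "ev k = Invoke i op" "k < l" "ev l = Return i op v"
      "\<And>m op'. k < m \<Longrightarrow> m < l \<Longrightarrow> ev m \<noteq> Invoke i op'"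
    unfolding returns_def by blast
  obtain k' where k': "pending i k' l" using Return_pending[OF l(3)] by blast
  have "k' = k"
  proof (rule ccontr)
    assume "k' \<noteq> k"
    moreover have "\<exists>op'. ev k' = Invoke i op'" "k' < l" using k' unfolding pending_def by auto
    ultimately show False using l pending_no_Invoke_between[OF k', of k]
      by (cases k k' rule: linorder_cases) auto
  qed
  then show "ev k = Invoke i op \<and> (\<exists>l. pending i k l \<and> ev l = Return i op v)" using l k' by blast
next
  assume "ev k = Invoke i op \<and> (\<exists>l. pending i k l \<and> ev l = Return i op v)"
  then obtain l where l: "ev k = Invoke i op" "pending i k l" "ev l = Return i op v" by blast
  then have "k < l" unfolding pending_def by blast
  then show "returns ev i k op v"
    unfolding returns_def using l pending_no_Invoke_between[OF l(2)] less_imp_le by blast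
qed

lemma pending_Return_unique:
  assumes "pending i k l" "ev l = Return i op v" "pending i k l'" "ev l' = Return i op' v'"
  shows "l = l'"
  using assms unfolding pending_def by (metis linorder_neqE_nat)

lemma returns_unique: "returns ev i k op v \<Longrightarrow> returns ev i k op v' \<Longrightarrow> v = v'"
  unfolding returns_iff using pending_Return_unique by (metis event.inject(2))

lemma not_returns_pending:
  assumes "ev k = Invoke i op" "\<nexists>v. returns ev i k op v" "k < l"
  shows "pending i k l"
proof -
  have "Suc k \<le> l" using assms(3) by simp
  then show ?thesis
  proof (induction l rule: dec_induct)
    case base
    then show ?case using pending_start assms(1) by blast
  next
    case (step l)
    have "ev l \<noteq> Return i op' v" for op' v
    proof
      assume r: "ev l = Return i op' v"
      then have "op' = op" using Return_pending[OF r] pending_unique step(3) assms(1) by fastforce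
      then show False using r step(3) assms unfolding returns_iff by blast
    qed
    then show ?case using step(3) pending_SucI by blast
  qed
qed

section \<open>Updates in the local sequences\<close>

lemma Invoke_returned:
  assumes "ev k = Invoke i op" "ev k' = Invoke i op'" "k < k'"
  shows "\<exists>l v. l < k' \<and> pending i k l \<and> ev l = Return i op v"
proof -
  have "\<not> pending i k k'" using pending_not_Invoke assms(2) by blast
  then obtain v where "returns ev i k op v" using not_returns_pending assms by blast
  then obtain l where l: "pending i k l" "ev l = Return i op v" unfolding returns_iff by blast
  have "l < k'"
  proof (rule ccontr)
    assume "\<not> l < k'"
    then show False using pending_antimono[OF l(1) assms(3)] \<open>\<not> pending i k k'\<close> by simp
  qed
  then show ?thesis using l by blast
qed

lemma Return_update_facts:
  assumes "pending i k l" "ev k = Invoke i (Update a)" "ev l = Return i op v"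
  shows "local_sn (st l i) = Suc (local_sn (st k i))"
    "\<exists>l'. k < l' \<and> l' < l \<and> ev l' = Apply i i (Suc (local_sn (st k i))) a \<and>
        v = out a (trace_of P (local_seq (st l' i)))"
proof -
  have "op = Update a" using Return_pending[OF assms(3)] assms(1,2) pending_unique by fastforce
  then have "phase (st l i) = Waiting a" "local_del (st l i) i = local_sn (st l i)" "result (st l i) = Some v"
    using Return_step[OF assms(3)] by (auto simp: lstep_Return)
  then show "local_sn (st l i) = Suc (local_sn (st k i))"
    "\<exists>l'. k < l' \<and> l' < l \<and> ev l' = Apply i i (Suc (local_sn (st k i))) a \<and>
        v = out a (trace_of P (local_seq (st l' i)))"
    using pending_update[OF assms(1,2)] by auto
qed

lemma update_local_sn_less:
  assumes "ev k = Invoke j (Update a)" "ev k' = Invoke j (Update a')" "k < k'"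
  shows "local_sn (st k j) < local_sn (st k' j)"
proof -
  obtain l v where l: "l < k'" "pending j k l" "ev l = Return j (Update a) v"
    using Invoke_returned[OF assms] by blast
  then have "local_sn (st l j) = Suc (local_sn (st k j))" using Return_update_facts(1) assms(1) by blast
  then show ?thesis using local_sn_mono[of l k' j] l(1) by simp
qed

lemma update_unique:
  assumes "ev k = Invoke j (Update a)" "ev k' = Invoke j (Update a')" "local_sn (st k j) = local_sn (st k' j)"
  shows "k = k'"
  using update_local_sn_less[OF assms(1,2)] update_local_sn_less[OF assms(2,1)] assms(3)
  by (cases k k' rule: linorder_cases) auto

definition nth_letter :: "'p \<Rightarrow> nat \<Rightarrow> 'a" where
  "nth_letter j n = (THE a. \<exists>k. ev k = Invoke j (Update a) \<and> local_sn (st k j) = n)"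

lemma nth_letter_eq:
  assumes "ev k = Invoke j (Update a)"
  shows "nth_letter j (local_sn (st k j)) = a"
  unfolding nth_letter_def
proof (rule the_equality)
  fix b assume "\<exists>k'. ev k' = Invoke j (Update b) \<and> local_sn (st k' j) = local_sn (st k j)"
  then obtain k' where k': "ev k' = Invoke j (Update b)" "local_sn (st k' j) = local_sn (st k j)" by blast
  then have "k' = k" using update_unique assms by blast
  then show "b = a" using k' assms by simp
qed (use assms in blast)

lemma broadcast_Invoke:
  assumes "ev b = RBroadcast j sn a"
  shows "\<exists>k<b. ev k = Invoke j (Update a) \<and> sn = Suc (local_sn (st k j))"
proof -
  have ph: "phase (st b j) = Accepted a" using RBroadcast_sn(1)[OF assms] .
  then obtain k where k: "pending j k b" using ex_pending by fastforce
  then obtain op where op: "ev k = Invoke j op" "k < b" unfolding pending_def by blast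
  show ?thesis
  proof (cases op)
    case (Update a')
    then have "a' = a" "local_sn (st b j) = local_sn (st k j)"
      using pending_update[OF k] op ph by auto
    then show ?thesis using op Update RBroadcast_sn(2)[OF assms] by auto
  next
    case (Query q)
    then show ?thesis using pending_query[OF k] op ph by simp
  qed
qed

lemma Apply_Invoke:
  assumes "ev l = Apply i j sn a"
  shows "\<exists>k<l. ev k = Invoke j (Update a) \<and> sn = Suc (local_sn (st k j))"
  using Apply_facts(6)[OF assms] broadcast_Invoke less_trans by metis

section \<open>Views and the words they spell\<close>

definition view_letters :: "(nat \<Rightarrow> ('p \<times> nat) option) \<Rightarrow> nat \<Rightarrow> ('p \<times> 'a) list" where
  "view_letters X l = (case X l of
       Some (j, k) \<Rightarrow> (case ev k of Invoke _ (Update a) \<Rightarrow> [(j, a)] | _ \<Rightarrow> [])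
     | None \<Rightarrow> [])"

definition view_word :: "(nat \<Rightarrow> ('p \<times> nat) option) \<Rightarrow> nat \<Rightarrow> ('p \<times> 'a) list" where
  "view_word X l = concat (map (view_letters X) [0..<l])"

lemma view_word_0 [simp]: "view_word X 0 = []"
  and view_word_Suc [simp]: "view_word X (Suc l) = view_word X l @ view_letters X l"
  unfolding view_word_def by auto

text \<open>Since \<open>nth_letter\<close> does not depend on the view, \<open>d\<close> fixes all
  projections of \<open>W\<close>, and the prefix relation between projections becomes an inequality
  between numbers.\<close>

definition counts :: "('p \<times> 'a) list \<Rightarrow> ('p \<Rightarrow> nat) \<Rightarrow> bool" where
  "counts W d \<longleftrightarrow> (\<forall>j. project j W = map (\<lambda>n. (j, nth_letter j n)) [0..<d j])"

lemma counts_append: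
  assumes "counts W d" "ev k = Invoke j (Update a)" "local_sn (st k j) = d j"
  shows "counts (W @ [(j, a)]) (d(j := Suc (d j)))"
  using assms nth_letter_eq[OF assms(2)] unfolding counts_def by auto

lemma issued_append: "issued P W \<Longrightarrow> ev k = Invoke j (Update a) \<Longrightarrow> issued P (W @ [(j, a)])"
  using Invoke_Update_facts(3) unfolding issued_def by auto

lemma counts_lang_extend:
  assumes "counts B d" "counts U d'" "issued P U" "\<And>p. d p \<le> d' p" "d j = d' j"
    and "a \<in> common P \<union> own P j"
    and "trace_of P (map snd B) \<in> lang P" "trace_of P (map snd B @ [a]) \<in> lang P"
    and "trace_of P (map snd U) \<in> lang P"
  shows "trace_of P (map snd U @ [a]) \<in> lang P"
proof (rule lang_extend[OF spec assms(3) _ _ assms(6-9)])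
  show "project j U = project j B" using assms(1,2,5) unfolding counts_def by simp
  show "\<exists>Z. project i U = project i B @ Z" for i
  proof -
    have "[0..<d' i] = [0..<d i] @ [d i..<d' i]"
      using assms(4)[of i] upt_add_eq_append[of 0 "d i" "d' i - d i"] by simp
    then show ?thesis using assms(1,2) unfolding counts_def by simp
  qed
qed

text \<open>\<open>occurs i l j k\<close>: the operation that \<open>j\<close> invoked at time \<open>k\<close> takes effect at \<open>i\<close> at time \<open>l\<close>.\<close>

definition occurs :: "'p \<Rightarrow> nat \<Rightarrow> 'p \<Rightarrow> nat \<Rightarrow> bool" where
  "occurs i l j k \<longleftrightarrow>
     (\<exists>a. ev k = Invoke j (Update a) \<and> ev l = Apply i j (Suc (local_sn (st k j))) a) \<or>
     j = i \<and> pending i k l \<and> (\<exists>q v. ev k = Invoke i (Query q) \<and> ev l = Return i (Query q) v)"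

lemma occurs_unique: "occurs i l j k \<Longrightarrow> occurs i l j' k' \<Longrightarrow> j = j' \<and> k = k'"
  unfolding occurs_def using update_unique pending_unique by auto

definition local_view :: "'p \<Rightarrow> nat \<Rightarrow> ('p \<times> nat) option" where
  "local_view i l = (if \<exists>j k. occurs i l j k then Some (THE (j, k). occurs i l j k) else None)"

lemma local_view_iff: "local_view i l = Some (j, k) \<longleftrightarrow> occurs i l j k"
proof -
  have the: "(THE (j, k). occurs i l j k) = (j', k')" if "occurs i l j' k'" for j' k'
    using that occurs_unique by (intro the_equality) fastforce+
  show ?thesis
  proof
    assume v: "local_view i l = Some (j, k)"
    then obtain j' k' where o: "occurs i l j' k'" unfolding local_view_def by (auto split: if_splits)
    then have "local_view i l = Some (j', k')" using the unfolding local_view_def by auto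
    then show "occurs i l j k" using v o by simp
  qed (use the in \<open>auto simp: local_view_def\<close>)
qed

lemma local_view_word:
  "map snd (view_word (local_view i) l) = local_seq (st l i) \<and>
   counts (view_word (local_view i) l) (local_del (st l i)) \<and>
   issued P (view_word (local_view i) l)"
proof (induction l)
  case 0
  then show ?case by (simp add: init init_lstate_def counts_def issued_def)
next
  case (Suc l)
  show ?case
  proof (cases "\<exists>j sn a. ev l = Apply i j sn a")
    case True
    then obtain j sn a where ap: "ev l = Apply i j sn a" by blast
    then obtain k where k: "ev k = Invoke j (Update a)" "sn = Suc (local_sn (st k j))"
      using Apply_Invoke by blast
    then have "local_view i l = Some (j, k)" unfolding local_view_iff occurs_def using ap by blast
    then have "view_letters (local_view i) l = [(j, a)]" unfolding view_letters_def using k by simp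
    moreover have "local_sn (st k j) = local_del (st l i) j" using Apply_facts(1)[OF ap] k by simp
    moreover from this have "counts (view_word (local_view i) l @ [(j, a)]) (local_del (st (Suc l) i))"
      using counts_append[OF _ k(1)] Suc Apply_facts(3)[OF ap] k(2) by simp
    ultimately show ?thesis using Suc Apply_facts(4)[OF ap] issued_append[OF _ k(1)] by simp
  next
    case False
    then have "view_letters (local_view i) l = []"
      unfolding view_letters_def occurs_def
      by (auto simp: local_view_iff occurs_def split: option.split event.split oper.split)
    then show ?thesis using Suc not_Apply_facts[of l i] False by simp
  qed
qed

lemmas local_view_seq = local_view_word[THEN conjunct1]
lemmas local_view_counts = local_view_word[THEN conjunct2, THEN conjunct1]
lemmas local_view_issued = local_view_word[THEN conjunct2, THEN conjunct2]

lemma local_view_lang: "trace_of P (map snd (view_word (local_view i) l)) \<in> lang P"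
  using local_seq_lang local_view_seq by simp

text \<open>The issuer tested \<open>a\<close> on its own sequence at time \<open>k\<close>. A legal
  word with at least those updates and no further one of \<open>j\<close> inherits the outcome by
  the diamond closure.\<close>

lemma Invoke_lang_extend:
  assumes "ev k = Invoke j (Update a)" "counts U d" "issued P U"
    and "\<And>p. local_del (st k j) p \<le> d p" "d j = local_sn (st k j)"
    and "trace_of P (map snd U) \<in> lang P"
  shows "trace_of P (map snd U @ [a]) \<in> lang P"
proof (rule counts_lang_extend[OF local_view_counts assms(2-4) _ _ local_view_lang _ assms(6)])
  show "local_del (st k j) j = d j" using Invoke_Update_facts(5)[OF assms(1)] assms(5) by simp
  show "a \<in> common P \<union> own P j" by (rule Invoke_Update_facts(3)[OF assms(1)])
  show "trace_of P (map snd (view_word (local_view j) k) @ [a]) \<in> lang P"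
    using Invoke_Update_facts(4)[OF assms(1)] local_view_seq by simp
qed

section \<open>Liveness\<close>

lemma correct_alive: "i \<notin> faulty_set st \<Longrightarrow> alive (st k i)"
  unfolding faulty_set_def by blast

lemma fair_Apply:
  assumes "i \<notin> faulty_set st" "\<And>l. N \<le> l \<Longrightarrow> enabled P out (st l) (Apply i j sn a)"
  shows "\<exists>l. ev l = Apply i j sn a"
proof -
  have "weakly_fair P out st ev {Apply i j sn a}" using exec assms(1) unfolding execution_def by blast
  then show ?thesis using assms(2) unfolding weakly_fair_def by blast
qed

lemma fair_op_step:
  assumes "i \<notin> faulty_set st" "\<And>l. N \<le> l \<Longrightarrow> \<exists>e \<in> op_steps i. enabled P out (st l) e"
  shows "\<exists>l\<ge>N. ev l \<in> op_steps i"
proof -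
  have "weakly_fair P out st ev (op_steps i)" using exec assms(1) unfolding execution_def by blast
  then show ?thesis using assms(2) unfolding weakly_fair_def by blast
qed

lemma delivered_all:
  assumes "ev r = RDeliver i' j sn a" "i \<notin> faulty_set st"
  shows "\<exists>r. ev r = RDeliver i j sn a"
  using crb[unfolded cr_broadcast_def, THEN conjunct2, THEN conjunct2, THEN conjunct2] assms by blast

text \<open>The induction descends because whatever the issuer had applied when it invoked
  \<open>a\<close> was broadcast before \<open>a\<close>. Termination-2 delivers those messages to
  \<open>i\<close> too; once they are applied, the handler of \<open>a\<close> stays enabled until
  it runs, and weak fairness makes it run.\<close>

lemma delivered_applied:
  assumes "i \<notin> faulty_set st" "ev b = RBroadcast j sn a" "ev r = RDeliver i j sn a"
  shows "\<exists>l. ev l = Apply i j sn a"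
  using assms(2,3)
proof (induction b arbitrary: j sn a r rule: less_induct)
  case (less b)
  show ?case
  proof (rule ccontr)
    assume never: "\<nexists>l. ev l = Apply i j sn a"
    obtain k where k: "k < b" "ev k = Invoke j (Update a)" "sn = Suc (local_sn (st k j))"
      using broadcast_Invoke[OF less.prems(1)] by blast
    have "\<exists>N. local_del (st k j) p \<le> local_del (st N i) p" for p
    proof (cases "local_del (st k j) p")
      case (Suc n)
      \<comment> \<open>The latest update of \<open>p\<close> known to the issuer suffices:
        processing it brings the counter of \<open>i\<close> at least that high.\<close>
      then obtain l' c where l': "l' < k" "ev l' = Apply j p (Suc n) c"
        using local_del_Apply[of "Suc n" k j p] by auto
      obtain b' where b': "b' < l'" "ev b' = RBroadcast p (Suc n) c" using Apply_facts(6)[OF l'(2)] by blast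
      obtain r' where "ev r' = RDeliver i p (Suc n) c"
        using Apply_facts(5)[OF l'(2)] delivered_all assms(1) by blast
      then obtain m where "ev m = Apply i p (Suc n) c"
        using less.IH[of b'] b' l' k(1) by force
      then have "Suc n \<le> local_del (st (Suc m) i) p" using Apply_local_del by blast
      then show ?thesis using Suc by metis
    qed simp
    then obtain f where f: "\<And>p. local_del (st k j) p \<le> local_del (st (f p) i) p" by metis
    \<comment> \<open>As there are finitely many processes, one time serves for all of them;
      \<open>Suc r\<close> ensures that the message has been delivered.\<close>
    define N where "N = max (Suc r) (Max (range f))"
    have known: "local_del (st k j) p \<le> local_del (st l i) p" if "N \<le> l" for p l
    proof -
      have "f p \<le> N" unfolding N_def by (simp add: le_max_iff_disj)
      then show ?thesis using f[of p] local_del_mono[of "f p" l i p] that by simp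
    qed
    have "enabled P out (st l) (Apply i j sn a)" if l: "N \<le> l" for l
    proof -
      have "(j, sn, a) \<in> waiting_msgs (st l i)"
        using delivered_waiting[OF less.prems(2)] never l unfolding N_def by simp
      \<comment> \<open>\<open>known\<close> bounds the counter from below. It cannot reach
        \<open>sn\<close> without processing a message of that number from \<open>j\<close>, which
        could only carry \<open>a\<close>.\<close>
      moreover have del: "local_del (st l i) j = local_sn (st k j)"
      proof -
        have "\<not> sn \<le> local_del (st l i) j"
        proof
          assume "sn \<le> local_del (st l i) j"
          then obtain l' c where l': "ev l' = Apply i j sn c" using local_del_Apply[of sn l i j] k(3) by auto
          then obtain b' where "ev b' = RBroadcast j sn c" using Apply_facts(6) by blast
          then have "c = a" using RBroadcast_unique less.prems(1) by blast
          then show False using never l' by blast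
        qed
        then show ?thesis using known[OF l, of j] Invoke_Update_facts(5)[OF k(2)] k(3) by simp
      qed
      moreover have "trace_of P (local_seq (st l i) @ [a]) \<in> lang P"
        using Invoke_lang_extend[OF k(2) local_view_counts local_view_issued known[OF l] del local_view_lang]
          local_view_seq by simp
      ultimately show ?thesis
        using correct_alive[OF assms(1)] Invoke_Update_facts(3)[OF k(2)] k(3)
        by (subst enabled_iff[of _ i]) (auto simp: lstep_Apply)
    qed
    then show False using fair_Apply[OF assms(1)] never by blast
  qed
qed

lemma applied_all:
  assumes "ev l = Apply i' j sn a" "i \<notin> faulty_set st"
  shows "\<exists>l. ev l = Apply i j sn a"
proof -
  obtain r where "ev r = RDeliver i j sn a" using Apply_facts(5)[OF assms(1)] delivered_all assms(2) by blast
  then show ?thesis using Apply_facts(6)[OF assms(1)] delivered_applied assms(2) by blast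
qed

lemma termination_query:
  assumes "i \<notin> faulty_set st" "ev k = Invoke i (Query q)"
  shows "\<exists>v. returns ev i k (Query q) v"
proof (rule ccontr)
  assume "\<nexists>v. returns ev i k (Query q) v"
  then have p: "pending i k l" if "k < l" for l using not_returns_pending assms(2) that by blast
  have ph: "phase (st l i) = Querying q" if "k < l" for l using pending_query p that assms(2) by blast
  have "\<exists>e \<in> op_steps i. enabled P out (st l) e" if "Suc k \<le> l" for l
    using ph[of l] that correct_alive[OF assms(1)]
    by (intro bexI[of _ "Return i (Query q) (q (trace_of P (local_seq (st l i))))"], subst enabled_iff[of _ i])
      (auto simp: lstep_Return op_steps_def)
  then obtain l where l: "Suc k \<le> l" "ev l \<in> op_steps i" using fair_op_step[OF assms(1)] by blast
  then consider op v where "ev l = Return i op v" | sn a where "ev l = RBroadcast i sn a"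
    unfolding op_steps_def by blast
  then show False
  proof cases
    case 1
    then show False using p[of "Suc l"] l unfolding pending_def by auto
  next
    case 2
    then show False using RBroadcast_sn(1) ph l by fastforce
  qed
qed

text \<open>Fairness is used once for the broadcast and once for the return. In between,
  Termination-1 brings the message back to its sender and \<open>delivered_applied\<close> has it
  processed.\<close>

lemma termination_update:
  assumes "i \<notin> faulty_set st" "ev k = Invoke i (Update a)"
  shows "\<exists>v. returns ev i k (Update a) v"
proof (rule ccontr)
  assume "\<nexists>v. returns ev i k (Update a) v"
  then have p: "pending i k l" if "k < l" for l using not_returns_pending assms(2) that by blast
  have no_return: "ev l \<noteq> Return i op v" if "k < l" for l op v
    using p[of "Suc l"] that unfolding pending_def by auto
  note upd = pending_update[OF p assms(2)]
  let ?s = "local_sn (st k i)"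
  have "\<exists>b. ev b = RBroadcast i (Suc ?s) a"
  proof (rule ccontr)
    assume never: "\<nexists>b. ev b = RBroadcast i (Suc ?s) a"
    then have ph: "phase (st l i) = Accepted a \<and> local_sn (st l i) = ?s" if "k < l" for l using upd[OF that] by blast
    have "\<exists>e \<in> op_steps i. enabled P out (st l) e" if "Suc k \<le> l" for l
      using ph[of l] that correct_alive[OF assms(1)]
      by (intro bexI[of _ "RBroadcast i (Suc ?s) a"], subst enabled_iff[of _ i])
        (auto simp: lstep_RBroadcast op_steps_def)
    then obtain l where l: "Suc k \<le> l" "ev l \<in> op_steps i" using fair_op_step[OF assms(1)] by blast
    then obtain sn b where br: "ev l = RBroadcast i sn b" using no_return[of l] unfolding op_steps_def by auto
    then have "b = a" "sn = Suc ?s" using RBroadcast_sn(1,2)[OF br] ph[of l] l by auto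
    then show False using br never by blast
  qed
  then obtain b where b: "ev b = RBroadcast i (Suc ?s) a" by blast
  then obtain r where "ev r = RDeliver i i (Suc ?s) a"
    using crb[unfolded cr_broadcast_def, THEN conjunct2, THEN conjunct2, THEN conjunct1] assms(1) by blast
  then obtain m where m: "ev m = Apply i i (Suc ?s) a" using delivered_applied assms(1) b by blast
  define N where "N = Suc (max k m)"
  have ph: "phase (st l i) = Waiting a \<and> local_del (st l i) i = local_sn (st l i) \<and> result (st l i) \<noteq> None"
    if "N \<le> l" for l
  proof -
    have "k < l" "m < l" using that unfolding N_def by auto
    then show ?thesis using Apply_local_del[OF m \<open>m < l\<close>] upd[OF \<open>k < l\<close>] by auto
  qed
  have "\<exists>e \<in> op_steps i. enabled P out (st l) e" if "N \<le> l" for l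
    using ph[OF that] correct_alive[OF assms(1)]
    by (intro bexI[of _ "Return i (Update a) (the (result (st l i)))"], subst enabled_iff[of _ i])
      (auto simp: lstep_Return op_steps_def)
  then obtain l where l: "N \<le> l" "ev l \<in> op_steps i" using fair_op_step[OF assms(1)] by blast
  then obtain sn b where br: "ev l = RBroadcast i sn b"
    using no_return[of l] unfolding op_steps_def N_def by auto
  then show False using RBroadcast_sn(1)[OF br] ph[OF l(1)] by simp
qed

lemma operation_returns:
  assumes "i \<notin> faulty_set st" "ev k = Invoke i op"
  shows "\<exists>v. returns ev i k op v"
  using termination_query termination_update assms by (cases op) auto

section \<open>The corrected history\<close>

text \<open>The applying process \<open>i\<close> may be any process, even a faulty one;
  \<open>applied_all\<close> then spreads the update to all correct ones. An update may thus be kept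
  without having returned.\<close>

definition kept :: "'p \<Rightarrow> nat \<Rightarrow> bool" where
  "kept j k \<longleftrightarrow> (\<exists>q v. ev k = Invoke j (Query q) \<and> returns ev j k (Query q) v) \<or>
     (\<exists>a i l. ev k = Invoke j (Update a) \<and> ev l = Apply i j (Suc (local_sn (st k j))) a)"

definition entry :: "'p \<Rightarrow> nat \<Rightarrow> ('a, 'p, 'v) invocation" where
  "entry j k = (let op = (THE op. ev k = Invoke j op) in (op, Some (invoked_value P out st ev j k op), j))"

definition corrected :: "('a, 'p, 'v) history" where
  "corrected = (\<lambda>j. sq_map (entry j) (sq_of_set {k. kept j k}))"

lemma entry_eq: "ev k = Invoke j op \<Longrightarrow> entry j k = (op, Some (invoked_value P out st ev j k op), j)"
  unfolding entry_def by simp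

lemma history_of_eq: "history_of P out st ev = (\<lambda>j. sq_map (entry j) (sq_of_set {k. \<exists>op. ev k = Invoke j op}))"
  unfolding history_of_def entry_def ..

lemma is_history: "is_history P (history_of P out st ev)"
  unfolding is_history_def is_local_history_def history_of_eq
  by (auto simp: is_sq_sq_map is_sq_sq_of_set sq_map_Some_iff sq_of_set_Some_iff entry_eq
      dest: Invoke_authorized)

lemma kept_Invoke: "kept j k \<Longrightarrow> \<exists>op. ev k = Invoke j op"
  unfolding kept_def by blast

lemma returns_kept:
  assumes "returns ev j k op v"
  shows "kept j k"
proof (cases op)
  case (Query q)
  then show ?thesis using assms unfolding kept_def returns_iff by blast
next
  case (Update a)
  then obtain l where l: "ev k = Invoke j (Update a)" "pending j k l" "ev l = Return j (Update a) v"
    using assms unfolding returns_iff by blast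
  then show ?thesis using Return_update_facts(2)[OF l(2,1,3)] unfolding kept_def by blast
qed

text \<open>An operation that is not kept has not returned. It blocks all later invocations of its
  process, hence is the last one, and termination for correct processes makes its process
  faulty.\<close>

lemma crash_corrected_corrected:
  "crash_corrected (faulty_set st) (history_of P out st ev) corrected"
  unfolding crash_corrected_def
proof
  fix j
  define I where "I = {k. \<exists>op. ev k = Invoke j op}"
  have H: "history_of P out st ev j = sq_map (entry j) (sq_of_set I)"
    unfolding history_of_eq I_def ..
  show "corrected j = history_of P out st ev j \<or>
    j \<in> faulty_set st \<and> drops_last (history_of P out st ev j) (corrected j)"
  proof (cases "\<forall>k\<in>I. kept j k")
    case True
    then have "{k. kept j k} = I" using kept_Invoke unfolding I_def by blast
    then show ?thesis unfolding H corrected_def by simp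
  next
    case False
    then obtain k op where k: "ev k = Invoke j op" "\<not> kept j k" unfolding I_def by blast
    then have none: "\<nexists>v. returns ev j k op v" using returns_kept by blast
    then have faulty: "j \<in> faulty_set st" using operation_returns k(1) by blast
    have last: "x \<le> k" if "x \<in> I" for x
    proof (rule ccontr)
      assume "\<not> x \<le> k"
      then have "pending j k x" using not_returns_pending[OF k(1) none] by simp
      then show False using that pending_not_Invoke unfolding I_def by blast
    qed
    have "kept j x" if x: "x \<in> I - {k}" for x
    proof -
      obtain op' where "ev x = Invoke j op'" using x unfolding I_def by blast
      moreover have "x < k" using x last[of x] by simp
      ultimately show ?thesis using Invoke_returned[OF _ k(1)] returns_kept returns_iff by blast
    qed
    then have "{k. kept j k} = I - {k}" using k(2) kept_Invoke unfolding I_def by blast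
    moreover have "k \<in> I" using k(1) unfolding I_def by blast
    ultimately show ?thesis
      using faulty drops_last_remove_Max[of k I "entry j"] last unfolding H corrected_def by simp
  qed
qed

definition perceived_entry :: "'p \<Rightarrow> 'p \<Rightarrow> nat \<Rightarrow> ('a, 'p, 'v) invocation" where
  "perceived_entry i j k = (if j = i then entry j k else mask (entry j k))"

lemma perceived_corrected:
  "perceived i corrected = (\<lambda>j. sq_map (perceived_entry i j)
     (sq_of_set {k. kept j k \<and> (j = i \<or> (\<exists>a. ev k = Invoke j (Update a)))}))"
proof
  fix j
  have "is_update (entry j k) \<longleftrightarrow> (\<exists>a. ev k = Invoke j (Update a))" if "kept j k" for k
    using kept_Invoke[OF that] by (auto simp: is_update_def entry_eq)
  then have "{k \<in> {k. kept j k}. is_update (entry j k)} = {k. kept j k \<and> (\<exists>a. ev k = Invoke j (Update a))}"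
    by blast
  then show "perceived i corrected j = sq_map (perceived_entry i j)
     (sq_of_set {k. kept j k \<and> (j = i \<or> (\<exists>a. ev k = Invoke j (Update a)))})"
    unfolding perceived_def corrected_def perceived_entry_def
    by (auto simp: sq_filter_sq_of_set) (auto simp: sq_map_def option.map_comp comp_def)
qed

text \<open>Values of other processes are masked and their queries absent, so only the values of
  \<open>i\<close> itself have to be checked against the view.\<close>

lemma view_serialization:
  assumes mem: "\<And>l j k. X l = Some (j, k) \<Longrightarrow> kept j k \<and> (j = i \<or> (\<exists>a. ev k = Invoke j (Update a)))"
    and all: "\<And>j k. kept j k \<Longrightarrow> j = i \<or> (\<exists>a. ev k = Invoke j (Update a)) \<Longrightarrow> \<exists>l. X l = Some (j, k)"
    and order: "\<And>l l' j k k'. \<lbrakk>l < l'; X l = Some (j, k); X l' = Some (j, k')\<rbrakk> \<Longrightarrow> k < k'"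
    and legal: "\<And>l. trace_of P (map snd (view_word X l)) \<in> lang P"
    and qry: "\<And>l k q. \<lbrakk>X l = Some (i, k); ev k = Invoke i (Query q)\<rbrakk> \<Longrightarrow>
        invoked_value P out st ev i k (Query q) = q (trace_of P (map snd (view_word X l)))"
    and upd: "\<And>l k a. \<lbrakk>X l = Some (i, k); ev k = Invoke i (Update a)\<rbrakk> \<Longrightarrow>
        invoked_value P out st ev i k (Update a) = out a (trace_of P (map snd (view_word X l)))"
  shows "\<exists>S. serialization S (perceived i corrected) \<and> pco_legal P out S"
proof -
  let ?g = "perceived_entry i"
  have g: "\<exists>op. ev k = Invoke j op \<and> ?g j k =
      (op, if j = i then Some (invoked_value P out st ev j k op) else None, j)" if X: "X l = Some (j, k)" for l j k
  proof -
    obtain op where "ev k = Invoke j op" using mem[OF X] kept_Invoke by blast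
    then show ?thesis unfolding perceived_entry_def by (auto simp: entry_eq mask_def)
  qed
  have "update_letters (?g j k) = map snd (view_letters X l)" if "X l = Some (j, k)" for l j k
    using g[OF that] that unfolding view_letters_def update_letters_def
    by (auto split: oper.split)
  then have "(case X l of Some (j, k) \<Rightarrow> update_letters (?g j k) | None \<Rightarrow> []) = map snd (view_letters X l)" for l
    by (auto simp: view_letters_def split: option.split)
  then have word: "arranged_updates ?g X l = map snd (view_word X l)" for l
    unfolding arranged_updates_def view_word_def by (simp add: map_concat comp_def)
  have "pco_legal P out (arrange ?g X)"
  proof (rule pco_legal_arrange, unfold word)
    fix l j k op val p
    assume "X l = Some (j, k)" "?g j k = (op, val, p)"
    then show "op \<in> authorized P p" using g Invoke_authorized by fastforce
  next
    fix l j k q val p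
    assume X: "X l = Some (j, k)" "?g j k = (Query q, val, p)"
    then have inv: "ev k = Invoke j (Query q)" using g[OF X(1)] by auto
    then have "j = i" using mem[OF X(1)] by auto
    then show "val = Some (q (trace_of P (map snd (view_word X l))))"
      using g[OF X(1)] X inv qry by auto
  next
    fix l j k a v p
    assume X: "X l = Some (j, k)" "?g j k = (Update a, Some v, p)"
    then have "j = i" "ev k = Invoke j (Update a)" "v = invoked_value P out st ev j k (Update a)"
      using g[OF X(1)] by (auto split: if_splits)
    then show "v = out a (trace_of P (map snd (view_word X l)))" using X upd by simp
  qed (rule legal)
  moreover have "serialization (arrange ?g X) (perceived i corrected)"
    unfolding perceived_corrected
  proof (rule serialization_arrange)
    show "k \<in> {k. kept j k \<and> (j = i \<or> (\<exists>a. ev k = Invoke j (Update a)))} \<longleftrightarrow> (\<exists>l. X l = Some (j, k))" for j k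
      using mem all by blast
  qed (rule order)
  ultimately show ?thesis by blast
qed

section \<open>Positions of operations in local views\<close>

lemma Apply_unique:
  assumes "ev l = Apply i j sn a" "ev l' = Apply i j sn a'"
  shows "l = l'"
  using Apply_local_del[OF assms(1), of l'] Apply_local_del[OF assms(2), of l]
    Apply_facts(1)[OF assms(1)] Apply_facts(1)[OF assms(2)]
  by (cases l l' rule: linorder_cases) auto

lemma Apply_letter_unique:
  assumes "ev l = Apply i j sn a" "ev l' = Apply i' j sn a'"
  shows "a = a'"
  using Apply_facts(6)[OF assms(1)] Apply_facts(6)[OF assms(2)] RBroadcast_unique by blast

lemma update_order:
  assumes "local_sn (st k j) < local_sn (st k' j)"
  shows "k < k'"
  using local_sn_mono[of k' k j] assms by (meson not_less)

text \<open>Had the operation returned earlier, it would have waited for this very message, which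
  would then be processed twice.\<close>

lemma own_Apply_pending:
  assumes "ev k = Invoke i (Update a)" "ev l = Apply i i (Suc (local_sn (st k i))) b"
  shows "pending i k l"
proof (rule ccontr)
  assume np: "\<not> pending i k l"
  obtain k' where k': "k' < l" "ev k' = Invoke i (Update b)" "local_sn (st k i) = local_sn (st k' i)"
    using Apply_Invoke[OF assms(2)] by auto
  then have "k < l" using update_unique[OF assms(1)] by blast
  then obtain v where "returns ev i k (Update a) v" using np not_returns_pending[OF assms(1)] by blast
  then obtain l' where l': "pending i k l'" "ev l' = Return i (Update a) v" unfolding returns_iff by blast
  have "l' < l"
  proof (rule ccontr)
    assume "\<not> l' < l"
    then show False using np pending_antimono[OF l'(1) \<open>k < l\<close>] by simp
  qed
  moreover obtain m where "m < l'" "ev m = Apply i i (Suc (local_sn (st k i))) a"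
    using Return_update_facts(2)[OF l'(1) assms(1) l'(2)] by blast
  ultimately show False using Apply_unique[OF assms(2)] by fastforce
qed

lemma occurs_own_pending: "occurs i l i k \<Longrightarrow> pending i k l"
  unfolding occurs_def using own_Apply_pending by blast

lemma occurs_kept: "occurs i l j k \<Longrightarrow> kept j k \<and> (j = i \<or> (\<exists>a. ev k = Invoke j (Update a)))"
  unfolding occurs_def kept_def returns_iff by blast

lemma occurs_alive: "occurs i l j k \<Longrightarrow> alive (st l i)"
  unfolding occurs_def by (auto intro!: alive_step)

text \<open>Two updates are ordered by their sequence numbers. If a query takes part, both
  operations belong to \<open>i\<close>, and operations of one process do not overlap.\<close>

lemma occurs_order:
  assumes "l < l'" and o: "occurs i l j k" and o': "occurs i l' j k'"
  shows "k < k'"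
proof (cases "(\<exists>a. ev k = Invoke j (Update a)) \<and> (\<exists>a. ev k' = Invoke j (Update a))")
  case True
  then obtain a a' where "ev l = Apply i j (Suc (local_sn (st k j))) a"
      and ap': "ev l' = Apply i j (Suc (local_sn (st k' j))) a'"
    using o o' unfolding occurs_def by auto
  then have "Suc (local_sn (st k j)) \<le> local_del (st l' i) j" using Apply_local_del assms(1) by blast
  then show ?thesis using Apply_facts(1)[OF ap'] by (intro update_order[of k j k']) simp
next
  case False
  then have "j = i" using o o' unfolding occurs_def by blast
  then have p: "pending i k l" "pending i k' l'" using o o' occurs_own_pending by auto
  have "k \<noteq> k'"
  proof
    assume "k = k'"
    then obtain q v where "ev l = Return i (Query q) v"
      using o o' False \<open>j = i\<close> unfolding occurs_def by auto
    moreover have "k < l" using p(1) unfolding pending_def by blast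
    ultimately show False using p(2) assms(1) \<open>k = k'\<close> unfolding pending_def by blast
  qed
  moreover have "\<not> k' < k"
  proof
    assume less: "k' < k"
    have kl: "k < l" "\<exists>op. ev k = Invoke i op" using p(1) unfolding pending_def by auto
    then have "pending i k' k" using pending_antimono[OF p(2) less] assms(1) by simp
    then show False using kl pending_not_Invoke by blast
  qed
  ultimately show ?thesis by simp
qed

section \<open>Values attributed to returned and interrupted operations\<close>

lemma invoked_value_returns:
  "returns ev i k op v \<Longrightarrow> invoked_value P out st ev i k op = v"
  unfolding invoked_value_def using returns_unique by (metis (mono_tags, lifting) the_equality)

lemma invoked_value_query:
  assumes "occurs i l i k" "ev k = Invoke i (Query q)"
  shows "invoked_value P out st ev i k (Query q) = q (trace_of P (local_seq (st l i)))"
proof -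
  obtain v where v: "pending i k l" "ev l = Return i (Query q) v"
    using assms unfolding occurs_def by auto
  then have "returns ev i k (Query q) v" using assms(2) unfolding returns_iff by blast
  moreover have "v = q (trace_of P (local_seq (st l i)))"
    using Return_step[OF v(2)] by (auto simp: lstep_Return)
  ultimately show ?thesis using invoked_value_returns by simp
qed

text \<open>For a faulty process this is one later than its \<open>Crash\<close> event. All its
  events have smaller times, so the slot \<open>crash_time i\<close> itself is free.\<close>

definition crash_time :: "'p \<Rightarrow> nat" where
  "crash_time i = (LEAST l. \<not> alive (st l i))"

lemma invoked_value_interrupted:
  assumes "\<nexists>v. returns ev i k op v"
  shows "invoked_value P out st ev i k op = interrupted_value P out i (st (crash_time i) i) op"
  unfolding invoked_value_def crash_time_def using assms by (rule if_not_P)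

lemma alive_iff_crash_time:
  assumes "i \<in> faulty_set st"
  shows "alive (st l i) \<longleftrightarrow> l < crash_time i"
proof -
  have "\<exists>l. \<not> alive (st l i)" using assms unfolding faulty_set_def by blast
  then have "\<not> alive (st (crash_time i) i)" unfolding crash_time_def by (rule LeastI_ex)
  then show ?thesis using alive_antimono[of "crash_time i" l i] not_less_Least[of l "\<lambda>l. \<not> alive (st l i)"]
    unfolding crash_time_def by (meson not_less)
qed

text \<open>The value is settled when the own message is applied: a return passes on
  \<open>result\<close>, and after a crash \<open>interrupted_value\<close> reads the same
  \<open>result\<close>.\<close>

lemma invoked_value_update:
  assumes inv: "ev k = Invoke i (Update a)" and ap: "ev l = Apply i i (Suc (local_sn (st k i))) a"
  shows "invoked_value P out st ev i k (Update a) = out a (trace_of P (local_seq (st l i)))"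
proof (cases "\<exists>v. returns ev i k (Update a) v")
  case True
  then obtain v where v: "returns ev i k (Update a) v" by blast
  then obtain l' where l': "pending i k l'" "ev l' = Return i (Update a) v" unfolding returns_iff by blast
  obtain m where "ev m = Apply i i (Suc (local_sn (st k i))) a" "v = out a (trace_of P (local_seq (st m i)))"
    using Return_update_facts(2)[OF l'(1) inv l'(2)] by blast
  then show ?thesis using Apply_unique[OF ap] invoked_value_returns[OF v] by simp
next
  case False
  then have "i \<in> faulty_set st" using operation_returns inv by blast
  then have lK: "l < crash_time i" using alive_iff_crash_time alive_step[of l i] ap by auto
  moreover have "k < l" using own_Apply_pending[OF inv ap] unfolding pending_def by blast
  ultimately have "pending i k (crash_time i)" using not_returns_pending[OF inv False] by simp
  from pending_update[OF this inv] Apply_local_del[OF ap lK]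
  obtain l' where l': "ev l' = Apply i i (Suc (local_sn (st k i))) a"
    and s: "phase (st (crash_time i) i) = Waiting a"
      "local_del (st (crash_time i) i) i = local_sn (st (crash_time i) i)"
      "result (st (crash_time i) i) = Some (out a (trace_of P (local_seq (st l' i))))"
    by auto
  have "l' = l" using Apply_unique l' ap by blast
  then show ?thesis using s unfolding invoked_value_interrupted[OF False] interrupted_value_def by simp
qed

text \<open>As the own message was not processed, \<open>interrupted_value\<close> does not use
  \<open>result\<close> but evaluates \<open>out\<close> on the last local sequence. This dictates
  the slot of the update in \<open>extended_view\<close>.\<close>

lemma invoked_value_unapplied:
  assumes inv: "ev k = Invoke i (Update a)" and faulty: "i \<in> faulty_set st"
    and na: "\<And>l b. ev l \<noteq> Apply i i (Suc (local_sn (st k i))) b"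
  shows "invoked_value P out st ev i k (Update a) = out a (trace_of P (local_seq (st (crash_time i) i)))"
    and "k < l \<Longrightarrow> pending i k l"
proof -
  have none: "\<nexists>v. returns ev i k (Update a) v"
    using Return_update_facts(2)[OF _ inv] na unfolding returns_iff by blast
  then show pend: "k < l \<Longrightarrow> pending i k l" for l using not_returns_pending[OF inv] by blast
  have "k < crash_time i" using alive_iff_crash_time[OF faulty] alive_step[of k i] inv by simp
  from pending_update[OF pend[OF this] inv] na
  have "\<not> (phase (st (crash_time i) i) = Waiting a \<and>
      local_del (st (crash_time i) i) i = local_sn (st (crash_time i) i))" by auto
  then show "invoked_value P out st ev i k (Update a) = out a (trace_of P (local_seq (st (crash_time i) i)))"
    unfolding invoked_value_interrupted[OF none] interrupted_value_def by auto
qed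

lemma correct_serialization:
  assumes "i \<notin> faulty_set st"
  shows "\<exists>S. serialization S (perceived i corrected) \<and> pco_legal P out S"
proof (rule view_serialization[of "local_view i"], unfold local_view_iff)
  fix j k assume k: "kept j k" "j = i \<or> (\<exists>a. ev k = Invoke j (Update a))"
  show "\<exists>l. occurs i l j k"
  proof (cases "\<exists>a. ev k = Invoke j (Update a)")
    case True
    then show ?thesis using k(1) applied_all assms unfolding kept_def occurs_def by fastforce
  next
    case False
    then show ?thesis using k unfolding kept_def occurs_def returns_iff by blast
  qed
next
  fix l k a assume "occurs i l i k" "ev k = Invoke i (Update a)"
  then show "invoked_value P out st ev i k (Update a) = out a (trace_of P (map snd (view_word (local_view i) l)))"
    using invoked_value_update unfolding local_view_seq occurs_def by auto
qed (use occurs_kept occurs_order local_view_lang invoked_value_query local_view_seq in auto)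

section \<open>The view of a faulty process\<close>

text \<open>The equation between the counters says that the message of this update, numbered one
  higher, is the next own message that \<open>i\<close> would have processed.\<close>

definition unapplied :: "'p \<Rightarrow> nat \<Rightarrow> bool" where
  "unapplied i k \<longleftrightarrow> (\<exists>a. ev k = Invoke i (Update a)) \<and> kept i k \<and>
     local_sn (st k i) = local_del (st (crash_time i) i) i"

text \<open>The counts reached once the crash slot is included; updates of smaller index are already
  in the view and must not be repeated.\<close>

definition final_count :: "'p \<Rightarrow> 'p \<Rightarrow> nat" where
  "final_count i j = local_del (st (crash_time i) i) j +
     (if j = i \<and> (\<exists>k. unapplied i k) then 1 else 0)"

text \<open>Slots before the crash follow \<open>i\<close> itself, and the crash slot takes the
  interrupted update if there is one. Afterwards the view of \<open>c\<close> is replayed from time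
  zero, hence the shift by \<open>Suc (crash_time i)\<close>, without its queries and without
  repetitions.\<close>

definition extended_view :: "'p \<Rightarrow> 'p \<Rightarrow> nat \<Rightarrow> ('p \<times> nat) option" where
  "extended_view c i l =
     (if l < crash_time i then local_view i l
      else if l = crash_time i
        then (if \<exists>k. unapplied i k then Some (i, THE k. unapplied i k) else None)
      else case local_view c (l - Suc (crash_time i)) of
          Some (j, k) \<Rightarrow>
            if (\<exists>a. ev k = Invoke j (Update a)) \<and> final_count i j \<le> local_sn (st k j)
            then Some (j, k) else None
        | None \<Rightarrow> None)"

lemma unapplied_unique: "unapplied i k \<Longrightarrow> unapplied i k' \<Longrightarrow> k = k'"
  unfolding unapplied_def using update_unique by auto

lemma extended_view_before: "l < crash_time i \<Longrightarrow> extended_view c i l = local_view i l"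
  unfolding extended_view_def by simp

lemma extended_view_crash: "extended_view c i (crash_time i) = Some (j, k) \<longleftrightarrow> j = i \<and> unapplied i k"
proof -
  have the: "(THE k. unapplied i k) = k" if "unapplied i k" for k
    using that unapplied_unique by blast
  show ?thesis
  proof (cases "\<exists>k. unapplied i k")
    case True
    then obtain k' where "unapplied i k'" by blast
    then show ?thesis using the[of k'] unapplied_unique[of i k k'] unfolding extended_view_def by auto
  next
    case False
    then show ?thesis unfolding extended_view_def by auto
  qed
qed

lemma extended_view_after:
  "extended_view c i (Suc (crash_time i + m)) = Some (j, k) \<longleftrightarrow>
     occurs c m j k \<and> (\<exists>a. ev k = Invoke j (Update a)) \<and> final_count i j \<le> local_sn (st k j)"
  unfolding extended_view_def
  by (auto simp: local_view_iff[symmetric] split: option.split)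

lemma view_position_cases:
  obtains (before) "l < crash_time i" | (crash) "l = crash_time i"
  | (after) m where "l = Suc (crash_time i + m)"
proof (cases l "crash_time i" rule: linorder_cases)
  case greater
  then show thesis using less_imp_Suc_add after by blast
qed (use before crash in auto)

context
  fixes i c :: 'p
  assumes faulty: "i \<in> faulty_set st" and correct: "c \<notin> faulty_set st"
begin

abbreviation (input) "K \<equiv> crash_time i"

lemma Invoke_before_crash: "ev k = Invoke i op \<Longrightarrow> k < K"
  using alive_iff_crash_time[OF faulty, of k] alive_step[of k i] by simp

lemma occurs_before_crash: "occurs i l j k \<Longrightarrow> l < K"
  using alive_iff_crash_time[OF faulty] occurs_alive by blast

lemma unapplied_not_Apply:
  assumes "unapplied i k"
  shows "ev l \<noteq> Apply i i (Suc (local_sn (st k i))) b"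
proof
  assume ap: "ev l = Apply i i (Suc (local_sn (st k i))) b"
  then have "l < K" using alive_iff_crash_time[OF faulty] alive_step[of l i] by simp
  then have "Suc (local_sn (st k i)) \<le> local_del (st K i) i" using Apply_local_del[OF ap] by blast
  then show False using assms unfolding unapplied_def by simp
qed

lemma unapplied_not_occurs: "unapplied i k \<Longrightarrow> \<not> occurs i l i k"
  using unapplied_not_Apply unfolding occurs_def unapplied_def by auto

lemma unapplied_pending: "unapplied i k \<Longrightarrow> k < l \<Longrightarrow> pending i k l"
  using invoked_value_unapplied(2)[OF _ faulty] unapplied_not_Apply unfolding unapplied_def by blast

text \<open>An own update of \<open>i\<close> has an index at most the own counter at the crash. In
  case of equality it is \<open>unapplied\<close> and counted by the extra one in
  \<open>final_count\<close>.\<close>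

lemma after_crash_not_own:
  assumes "extended_view c i (Suc (K + m)) = Some (j, k)"
  shows "j \<noteq> i"
proof
  assume "j = i"
  then have o: "occurs c m i k" and le: "final_count i i \<le> local_sn (st k i)"
    and "\<exists>a. ev k = Invoke i (Update a)"
    using assms unfolding extended_view_after by auto
  then obtain a where inv: "ev k = Invoke i (Update a)" by blast
  have "local_sn (st k i) = local_del (st k i) i" using Invoke_Update_facts(5)[OF inv] by simp
  also have "\<dots> \<le> local_del (st K i) i" using local_del_mono Invoke_before_crash[OF inv] by simp
  finally have "local_sn (st k i) = local_del (st K i) i" using le unfolding final_count_def by simp
  moreover from this have "unapplied i k" using inv occurs_kept[OF o] unfolding unapplied_def by blast
  then have "final_count i i = Suc (local_del (st K i) i)" unfolding final_count_def by auto
  ultimately show False using le by simp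
qed

lemma view_word_before:
  assumes "l \<le> K"
  shows "view_word (extended_view c i) l = view_word (local_view i) l"
  using assms by (induction l) (auto simp: view_letters_def extended_view_before)

text \<open>The interrupted update passed the test at its invocation. By \<open>sn\<close>, only
  updates of others were applied since, so the diamond closure still admits it.\<close>

lemma view_word_crash:
  "counts (view_word (extended_view c i) (Suc K)) (final_count i) \<and>
   issued P (view_word (extended_view c i) (Suc K)) \<and>
   trace_of P (map snd (view_word (extended_view c i) (Suc K))) \<in> lang P"
proof (cases "\<exists>k. unapplied i k")
  case True
  then obtain k where k: "unapplied i k" by blast
  then obtain a where inv: "ev k = Invoke i (Update a)" unfolding unapplied_def by blast
  have sn: "local_del (st K i) i = local_sn (st k i)" using k unfolding unapplied_def by simp
  have "extended_view c i K = Some (i, k)" using k extended_view_crash by blast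
  then have word: "view_word (extended_view c i) (Suc K) = view_word (local_view i) K @ [(i, a)]"
    using view_word_before[of K] inv by (simp add: view_letters_def)
  have count: "final_count i = (local_del (st K i))(i := Suc (local_del (st K i) i))"
    using k by (auto simp: fun_eq_iff final_count_def)
  have "local_del (st k i) p \<le> local_del (st K i) p" for p
    using local_del_mono Invoke_before_crash[OF inv] by simp
  then have "trace_of P (map snd (view_word (local_view i) K) @ [a]) \<in> lang P"
    using Invoke_lang_extend[OF inv local_view_counts local_view_issued _ sn local_view_lang] by blast
  then show ?thesis unfolding word count
    using counts_append[OF local_view_counts inv sn[symmetric]] issued_append[OF local_view_issued inv] by simp
next
  case False
  then have "extended_view c i K = None" unfolding extended_view_def by simp
  then have "view_word (extended_view c i) (Suc K) = view_word (local_view i) K"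
    using view_word_before[of K] by (simp add: view_letters_def)
  moreover have "final_count i = local_del (st K i)" using False by (auto simp: fun_eq_iff final_count_def)
  ultimately show ?thesis using local_view_counts local_view_issued local_view_lang by simp
qed

text \<open>The word merges what \<open>i\<close> had at the crash with what \<open>c\<close>
  applied before time \<open>m\<close>. For each issuer both are initial segments of the same
  sequence, so their union is counted by the maximum.\<close>

lemma view_word_after:
  "counts (view_word (extended_view c i) (Suc (K + m))) (\<lambda>j. max (final_count i j) (local_del (st m c) j)) \<and>
   issued P (view_word (extended_view c i) (Suc (K + m))) \<and>
   trace_of P (map snd (view_word (extended_view c i) (Suc (K + m)))) \<in> lang P"
proof (induction m)
  case 0
  have "(\<lambda>j. max (final_count i j) (local_del (st 0 c) j)) = final_count i"
    by (simp add: init init_lstate_def)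
  then show ?case using view_word_crash by simp
next
  case (Suc m)
  let ?X = "extended_view c i" and ?l = "Suc (K + m)"
  let ?d = "\<lambda>m j. max (final_count i j) (local_del (st m c) j)"
  have Suc_word: "view_word ?X (Suc (K + Suc m)) = view_word ?X ?l @ view_letters ?X ?l" by simp
  show ?case
  proof (cases "\<exists>j sn a. ev m = Apply c j sn a")
    case True
    then obtain j sn a where ap: "ev m = Apply c j sn a" by blast
    then obtain k where k: "ev k = Invoke j (Update a)" "sn = Suc (local_sn (st k j))"
      using Apply_Invoke by blast
    have o: "occurs c m j k" unfolding occurs_def using ap k by blast
    have del: "local_del (st m c) j = local_sn (st k j)" using Apply_facts(1)[OF ap] k(2) by simp
    have del': "local_del (st (Suc m) c) = (local_del (st m c))(j := Suc (local_sn (st k j)))"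
      using Apply_facts(3)[OF ap] k(2) by simp
    \<comment> \<open>An index below \<open>final_count\<close> means that the update is already
      present; the slot stays empty and the maximum does not change.\<close>
    show ?thesis
    proof (cases "final_count i j \<le> local_sn (st k j)")
      case True
      then have "?X ?l = Some (j, k)" unfolding extended_view_after using o k by blast
      then have letters: "view_letters ?X ?l = [(j, a)]" using k by (simp add: view_letters_def)
      have dj: "?d m j = local_sn (st k j)" using True del by simp
      have "?d (Suc m) = (?d m)(j := Suc (?d m j))" using True del unfolding del' by auto
      \<comment> \<open>The smaller word is what \<open>c\<close> had applied before time
        \<open>m\<close>, where its handler tested \<open>a\<close>.\<close>
      moreover have "trace_of P (map snd (view_word ?X ?l) @ [a]) \<in> lang P"
      proof (rule counts_lang_extend[where B = "view_word (local_view c) m" and j = j])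
        show "trace_of P (map snd (view_word (local_view c) m) @ [a]) \<in> lang P"
          using local_seq_lang[of "Suc m" c] Apply_facts(4)[OF ap] local_view_seq by simp
        show "local_del (st m c) j = ?d m j" using dj del by simp
        show "a \<in> common P \<union> own P j" by (rule Invoke_Update_facts(3)[OF k(1)])
      qed (use Suc local_view_counts local_view_lang in auto)
      moreover have "issued P (view_word ?X ?l @ [(j, a)])" using issued_append[OF _ k(1)] Suc by blast
      ultimately show ?thesis unfolding Suc_word letters
        using counts_append[of "view_word ?X ?l" "?d m", OF _ k(1)] dj Suc by simp
    next
      case False
      have "?X ?l = None"
      proof (rule ccontr)
        assume "?X ?l \<noteq> None"
        then obtain j' k' where X: "?X ?l = Some (j', k')" by auto
        then have "j' = j" "k' = k" using occurs_unique[OF o] unfolding extended_view_after by auto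
        then show False using X False unfolding extended_view_after by simp
      qed
      moreover have "?d (Suc m) = ?d m" using False del unfolding del' by (auto simp: fun_eq_iff)
      ultimately show ?thesis using Suc unfolding Suc_word by (simp add: view_letters_def)
    qed
  next
    case False
    have "?X ?l = None"
    proof (rule ccontr)
      assume "?X ?l \<noteq> None"
      then obtain j' k' where "?X ?l = Some (j', k')" by auto
      then show False using False unfolding extended_view_after occurs_def by auto
    qed
    then show ?thesis using Suc not_Apply_facts(1)[of m c] False unfolding Suc_word
      by (simp add: view_letters_def)
  qed
qed

lemma extended_view_lang: "trace_of P (map snd (view_word (extended_view c i) l)) \<in> lang P"
proof (cases rule: view_position_cases[of l i])
  case (after m)
  then show ?thesis using view_word_after by blast
qed (use view_word_before local_view_lang in auto)

lemma extended_view_kept: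
  assumes "extended_view c i l = Some (j, k)"
  shows "kept j k \<and> (j = i \<or> (\<exists>a. ev k = Invoke j (Update a)))"
proof (cases rule: view_position_cases[of l i])
  case before
  then show ?thesis using assms occurs_kept by (simp add: extended_view_before local_view_iff)
next
  case crash
  then show ?thesis using assms extended_view_crash[of c i j k] unfolding unapplied_def by simp
next
  case (after m)
  then show ?thesis using assms extended_view_after[of c i m j k] occurs_kept[of c m j k] by simp
qed

lemma extended_view_complete:
  assumes kept: "kept j k" and "j = i \<or> (\<exists>a. ev k = Invoke j (Update a))"
  shows "\<exists>l. extended_view c i l = Some (j, k)"
proof (cases "\<exists>a. ev k = Invoke j (Update a)")
  case False
  then have "j = i" using assms(2) by blast
  moreover obtain q v where "ev k = Invoke j (Query q)" "returns ev j k (Query q) v"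
    using kept False unfolding kept_def by blast
  ultimately obtain l where "occurs i l j k" unfolding occurs_def returns_iff by blast
  then show ?thesis using occurs_before_crash extended_view_before local_view_iff by metis
next
  case True
  then obtain a where inv: "ev k = Invoke j (Update a)" by blast
  obtain i' l' where ap: "ev l' = Apply i' j (Suc (local_sn (st k j))) a"
    using kept inv unfolding kept_def by auto
  \<comment> \<open>An index between the counter of \<open>i\<close> at the crash and
    \<open>final_count\<close> can only be the extra one in \<open>final_count\<close>, which is the
    interrupted update.\<close>
  consider (later) "final_count i j \<le> local_sn (st k j)"
    | (applied) "local_sn (st k j) < local_del (st K i) j"
    | (own) "j = i" "unapplied i k"
  proof -
    assume c1: "final_count i j \<le> local_sn (st k j) \<Longrightarrow> thesis"
      and c2: "local_sn (st k j) < local_del (st K i) j \<Longrightarrow> thesis"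
      and c3: "j = i \<Longrightarrow> unapplied i k \<Longrightarrow> thesis"
    show thesis
    proof (cases "final_count i j \<le> local_sn (st k j) \<or> local_sn (st k j) < local_del (st K i) j")
      case False
      then have "j = i" "local_sn (st k i) = local_del (st K i) i"
        unfolding final_count_def by (auto split: if_splits)
      then show thesis using c3 kept inv unfolding unapplied_def by blast
    qed (use c1 c2 in blast)
  qed
  then show ?thesis
  proof cases
    case later
    obtain m where "ev m = Apply c j (Suc (local_sn (st k j))) a" using applied_all[OF ap correct] by blast
    then have "occurs c m j k" unfolding occurs_def using inv by blast
    then show ?thesis using later inv extended_view_after by blast
  next
    case applied
    then obtain l b where "ev l = Apply i j (Suc (local_sn (st k j))) b"
      using local_del_Apply[of "Suc (local_sn (st k j))" K i j] by auto
    moreover from this have "b = a" using Apply_letter_unique ap by blast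
    ultimately have "occurs i l j k" unfolding occurs_def using inv by blast
    then show ?thesis using occurs_before_crash extended_view_before local_view_iff by metis
  next
    case own
    then show ?thesis using extended_view_crash by blast
  qed
qed

lemma extended_view_order:
  assumes "l < l'" and X: "extended_view c i l = Some (j, k)" and X': "extended_view c i l' = Some (j, k')"
  shows "k < k'"
proof (cases rule: view_position_cases[of l' i])
  case before
  then have "occurs i l j k" "occurs i l' j k'"
    using assms by (auto simp: extended_view_before local_view_iff)
  then show ?thesis using occurs_order assms(1) by blast
next
  case crash
  then have o: "occurs i l j k" and j: "j = i" and k': "unapplied i k'"
    using assms extended_view_crash by (auto simp: extended_view_before local_view_iff)
  have "k \<noteq> k'" using unapplied_not_occurs k' o j by blast
  moreover have "\<not> k' < k"
    using unapplied_pending[OF k'] pending_not_Invoke kept_Invoke occurs_kept[OF o] j by blast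
  ultimately show ?thesis by simp
next
  case (after m')
  then have j: "j \<noteq> i" and o': "occurs c m' j k'" and le: "final_count i j \<le> local_sn (st k' j)"
    using X' after_crash_not_own[of m' j k'] extended_view_after[of c i m' j k'] by simp_all
  show ?thesis
  proof (cases rule: view_position_cases[of l i])
    case before
    then have "occurs i l j k" using X by (simp add: extended_view_before local_view_iff)
    then obtain a where "ev l = Apply i j (Suc (local_sn (st k j))) a" using j unfolding occurs_def by blast
    \<comment> \<open>An update processed before the crash has an index below
      \<open>final_count\<close>, a replayed one does not.\<close>
    then have "Suc (local_sn (st k j)) \<le> local_del (st K i) j" using Apply_local_del before by blast
    then show ?thesis using le unfolding final_count_def by (intro update_order[of k j k']) simp
  next
    case crash
    then show ?thesis using X extended_view_crash[of c i j k] j by simp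
  next
    case (after m)
    then have "occurs c m j k" "m < m'" using X extended_view_after[of c i m j k] assms(1) \<open>l' = Suc (K + m')\<close> by simp_all
    then show ?thesis using o' occurs_order by blast
  qed
qed

lemma faulty_serialization: "\<exists>S. serialization S (perceived i corrected) \<and> pco_legal P out S"
proof (rule view_serialization[of "extended_view c i"])
  fix l k q assume X: "extended_view c i l = Some (i, k)" and inv: "ev k = Invoke i (Query q)"
  show "invoked_value P out st ev i k (Query q) = q (trace_of P (map snd (view_word (extended_view c i) l)))"
  proof (cases rule: view_position_cases[of l i])
    case before
    then show ?thesis using X inv invoked_value_query view_word_before local_view_seq
      by (simp add: extended_view_before local_view_iff)
  next
    case crash
    then show ?thesis using X inv extended_view_crash[of c i i k] unfolding unapplied_def by simp
  next
    case (after m)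
    then show ?thesis using X after_crash_not_own[of m i k] by simp
  qed
next
  fix l k a assume X: "extended_view c i l = Some (i, k)" and inv: "ev k = Invoke i (Update a)"
  show "invoked_value P out st ev i k (Update a) = out a (trace_of P (map snd (view_word (extended_view c i) l)))"
  proof (cases rule: view_position_cases[of l i])
    case before
    then have "occurs i l i k" using X by (simp add: extended_view_before local_view_iff)
    then have "ev l = Apply i i (Suc (local_sn (st k i))) a" using inv unfolding occurs_def by auto
    then show ?thesis using before inv invoked_value_update view_word_before local_view_seq by simp
  next
    case crash
    then have "unapplied i k" using X extended_view_crash[of c i i k] by simp
    then show ?thesis using crash invoked_value_unapplied(1)[OF inv faulty] unapplied_not_Apply
        view_word_before local_view_seq by simp
  next
    case (after m)
    then show ?thesis using X after_crash_not_own[of m i k] by simp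
  qed
qed (use extended_view_kept extended_view_complete extended_view_order extended_view_lang in blast)+

end

lemma operation_enabled:
  assumes "alive (st k i)" "phase (st k i) = Idle" "op \<in> authorized P i"
    and "\<And>a. op = Update a \<Longrightarrow> trace_of P (local_seq (st k i) @ [a]) \<in> lang P"
  shows "enabled P out (st k) (Invoke i op)"
  using assms unfolding authorized_def
  by (subst enabled_iff[of _ i]) (auto simp: lstep_Invoke)

lemma perceived_serialization:
  assumes "t < CARD('p)"
  shows "\<exists>S. serialization S (perceived i corrected) \<and> pco_legal P out S"
proof -
  have "card (faulty_set st) \<le> t" using exec unfolding execution_def by blast
  \<comment> \<open>The bound on \<open>t\<close> leaves a correct process, whose view continues
    those of the faulty ones.\<close>
  then have "faulty_set st \<noteq> UNIV" using assms by auto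
  then obtain c where "c \<notin> faulty_set st" by blast
  then show ?thesis using correct_serialization faulty_serialization by blast
qed

end

theorem theorem1:
  fixes P :: "('a, 'p::finite, 'v) pco"
    and out :: "'a \<Rightarrow> 'a trace \<Rightarrow> 'v"
    and t :: nat
    and st :: "nat \<Rightarrow> 'p \<Rightarrow> ('a, 'p, 'v) lstate"
    and ev :: "nat \<Rightarrow> ('a, 'p, 'v) event"
  assumes "pco_spec P"
    and "t < CARD('p)"
    and "execution P out t st ev"
  shows "(\<forall>i k op. alive (st k i) \<and> phase (st k i) = Idle \<and> op \<in> authorized P i \<and>
            (\<forall>a. op = Update a \<longrightarrow> trace_of P (local_seq (st k i) @ [a]) \<in> lang P)
            \<longrightarrow> enabled P out (st k) (Invoke i op)) \<and>
         is_history P (history_of P out st ev) \<and>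
         (\<forall>i k op. i \<notin> faulty_set st \<and> ev k = Invoke i op \<longrightarrow> (\<exists>v. returns ev i k op v)) \<and>
         (\<exists>H'. crash_corrected (faulty_set st) (history_of P out st ev) H' \<and>
            (\<forall>i. \<exists>S. serialization S (perceived i H') \<and> pco_legal P out S))"
proof -
  interpret pco_execution P out t st ev using assms by unfold_locales
  show ?thesis
    using operation_enabled is_history operation_returns crash_corrected_corrected
      perceived_serialization[OF assms(2)] by blast
qed

end
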